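(* Let $\mathbb{K}$ be a field containing $\mathbb{Q}$, let $n\ge1$ be an integer and $\mathbf{x}=\{x_1,\dots,x_n\}$ noncommuting variables, with $\mathcal{N}$, $m_w$, $\mathbf{m}_\mu$ and $\Lambda$ as in the context. Let $\mathcal{C}$ be the subalgebra of $\mathcal{N}$ generated by $\{m_v: v\text{ a bimodal word}\}$. Then $\mathcal{C}$ has a basis indexed by the restricted growth words $w$ (with letters in $\{1,\dots,n\}$) whose bimodal decomposition is tail-free, namely the products $m_{w'}m_{w''}\cdots m_{w^{(r)}}$ where $w=w'|w''|\cdots|w^{(r)}$ is the bimodal decomposition. Moreover, the linear map $\varphi:\mathcal{C}\otimes\Lambda\to\mathcal{N}$ defined by $$m_{w'}m_{w''}\cdots m_{w^{(r)}}\otimes\mathbf{m}_\mu\;\longmapsto\; m_{w'w''\cdots w^{(r)}\,\mathsf{w}(\mu)}$$ (concatenation of words) is a vector space isomorphism.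
   Context: Degree-$d$ monomials are functions $\mathbf{z}:[d]\to\mathbf{x}$; the type $\tau(\mathbf{z})$ is the set partition of $[d]$ into nonempty fibers of $\mathbf{z}$; $m_{\mathbf{A}}=\sum_{\tau(\mathbf{z})=\mathbf{A}}\mathbf{z}$ ($=0$ if $\mathbf{A}$ has more than $n$ blocks), $m_\emptyset=1$; $\mathcal{N}=\mathrm{span}\{m_{\mathbf{A}}\}\subseteq\mathbb{K}\langle\mathbf{x}\rangle$ is the algebra of $\mathfrak{S}_n$-invariants under permuting variables. For $\mathbf{A}=\{A_1,\dots,A_r\}$ with blocks ordered by increasing minima, its restricted growth word is $\mathsf{w}(\mathbf{A})=w_1\cdots w_d$ with $w_i=k$ iff $i\in A_k$; this is a bijection onto restricted growth words, i.e. words $w_1\cdots w_d$ over positive integers with $w_1=1$ and $w_i\le1+\max(w_1,\dots,w_{i-1})$. Write $m_w=m_{\mathbf{A}}$ when $w=\mathsf{w}(\mathbf{A})$. Shape $\lambda(\mathbf{A})$ = partition of block sizes; for a partition $\mu=1^{a_1}2^{a_2}\cdots$ of $d$ with $\mathcal{N}_\mu=\mathrm{span}\{m_{\mathbf{A}}:\lambda(\mathbf{A})=\mu\}\neq0$, $\mathbf{m}_\mu=\frac{1}{(\dim\mathcal{N}_\mu)a_1!a_2!\cdots}\sum_{\lambda(\mathbf{A})=\mu}m_{\mathbf{A}}$, and $\Lambda=\mathrm{span}\{\mathbf{m}_\mu\}$ (the partitions $\mu$ with at most $n$ parts, including the empty one, with $\mathbf{m}_\emptyset=1$). For $\mu=(\mu_1\ge\cdots\ge\mu_k>0)$,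 $\mathsf{w}(\mu)=1^{\mu_1}2^{\mu_2}\cdots k^{\mu_k}$; words of this form (including the empty word) are called convex. A restricted growth word $w_1\cdots w_d$ is primary if for no $i>1$ is $w_i\cdots w_d$ a restricted growth word. Every restricted growth word factors uniquely as a concatenation of primary words (its maximal splitting). The bimodal decomposition $w=w'|\cdots|w^{(r)}|w^{(r+1)}$ of $w$ is obtained from its maximal splitting $p_1|p_2|\cdots|p_k$ by scanning left to right and accumulating consecutive primary factors as long as the accumulated concatenation is convex; as soon as appending the next primary factor makes the accumulated word non-convex, that accumulated word (including this factor) is closed off as a bimodal factor and accumulation restarts; the final accumulated (convex, possibly empty) word $w^{(r+1)}$ is the tail. A bimodal word is a restricted growth word $p_1\cdots p_j$ ($p_i$ primary, $j\ge1$) with $p_1\cdots p_{j-1}$ convex (possibly empty) and $p_1\cdots p_j$ not convex, i.e. a word whose bimodal decomposition is itself with empty tail. The decomposition is tail-free if $w^{(r+1)}$ is empty. *)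

theory Defs
  imports Complex_Main "HOL-Library.Poly_Mapping" "HOL-Library.Disjoint_Sets"
    "HOL-Library.Multiset" "HOL-Library.FuncSet"
begin

section \<open>The free associative algebra\<close>

text \<open>
  A monomial is a word in the variables; the letter \<open>i\<close> stands for the variable \<open>x\<^sub>i\<close>. The free
  monoid is written additively because multiplication on \<^typ>\<open>'a \<Rightarrow>\<^sub>0 'b\<close> is convolution along
  the addition of \<^typ>\<open>'a\<close>; with this instance \<open>monomial \<Rightarrow>\<^sub>0 'k\<close> is the free associative algebra.
\<close>

datatype monomial = Mon (letters: "nat list")

instantiation monomial :: monoid_add
begin

definition zero_monomial :: monomial where "0 = Mon []"

definition plus_monomial :: "monomial \<Rightarrow> monomial \<Rightarrow> monomial" where
  "u + v = Mon (letters u @ letters v)"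

instance
  by standard (simp_all add: zero_monomial_def plus_monomial_def)

end

type_synonym 'k ncpoly = "monomial \<Rightarrow>\<^sub>0 'k"

definition pm_scale :: "'k::comm_ring_1 \<Rightarrow> ('a \<Rightarrow>\<^sub>0 'k) \<Rightarrow> ('a \<Rightarrow>\<^sub>0 'k)" where
  "pm_scale c f = Poly_Mapping.map ((*) c) f"

lemma lookup_pm_scale [simp]:
  "Poly_Mapping.lookup (pm_scale c f) a = c * Poly_Mapping.lookup f a"
  unfolding pm_scale_def by transfer (auto simp: when_def)

global_interpretation pm: vector_space "pm_scale :: 'k::field \<Rightarrow> ('a \<Rightarrow>\<^sub>0 'k) \<Rightarrow> ('a \<Rightarrow>\<^sub>0 'k)"
  by standard (auto intro!: poly_mapping_eqI simp: lookup_add algebra_simps)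

definition subalgebra :: "'k::field ncpoly set \<Rightarrow> bool" where
  "subalgebra S \<longleftrightarrow> pm.subspace S \<and> 1 \<in> S \<and> (\<forall>f\<in>S. \<forall>g\<in>S. f * g \<in> S)"

definition basis_family :: "'i set \<Rightarrow> ('i \<Rightarrow> ('a \<Rightarrow>\<^sub>0 'k::field)) \<Rightarrow> ('a \<Rightarrow>\<^sub>0 'k) set \<Rightarrow> bool" where
  "basis_family I b V \<longleftrightarrow> inj_on b I \<and> pm.independent (b ` I) \<and> pm.span (b ` I) = V"

definition linear_map_on ::
    "('k \<Rightarrow> 'v \<Rightarrow> 'v) \<Rightarrow> ('k \<Rightarrow> 'w \<Rightarrow> 'w) \<Rightarrow> 'v::plus set \<Rightarrow> ('v \<Rightarrow> 'w::plus) \<Rightarrow> bool" where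
  "linear_map_on s1 s2 V \<phi> \<longleftrightarrow>
     (\<forall>x\<in>V. \<forall>y\<in>V. \<phi> (x + y) = \<phi> x + \<phi> y) \<and> (\<forall>c. \<forall>x\<in>V. \<phi> (s1 c x) = s2 c (\<phi> x))"

section \<open>Tensor products of subspaces\<close>

text \<open>
  For subspaces \<open>U\<close> and \<open>V\<close> of \<open>'a \<Rightarrow>\<^sub>0 'k\<close> and \<open>'b \<Rightarrow>\<^sub>0 'k\<close> the tensor product \<open>U \<otimes> V\<close> is realised as
  the span of the pure tensors inside \<open>('a \<times> 'b) \<Rightarrow>\<^sub>0 'k\<close>, the tensor product of the two ambient
  spaces. Over a field this is the tensor product up to unique isomorphism: its universal
  property is the lemma \<open>tensor_space_universal\<close>.
\<close>

lift_definition pure_tensor :: "('a \<Rightarrow>\<^sub>0 'k) \<Rightarrow> ('b \<Rightarrow>\<^sub>0 'k) \<Rightarrow> ('a \<times> 'b \<Rightarrow>\<^sub>0 'k::comm_ring_1)"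
  is "\<lambda>f g (a, b). f a * g b"
proof -
  fix f :: "'a \<Rightarrow> 'k" and g :: "'b \<Rightarrow> 'k"
  assume "finite {a. f a \<noteq> 0}" "finite {b. g b \<noteq> 0}"
  then have "finite ({a. f a \<noteq> 0} \<times> {b. g b \<noteq> 0})" by simp
  then show "finite {x. (case x of (a, b) \<Rightarrow> f a * g b) \<noteq> 0}"
    by (rule rev_finite_subset) auto
qed

definition tensor_space ::
    "('a \<Rightarrow>\<^sub>0 'k::field) set \<Rightarrow> ('b \<Rightarrow>\<^sub>0 'k) set \<Rightarrow> ('a \<times> 'b \<Rightarrow>\<^sub>0 'k) set" where
  "tensor_space U V = pm.span {pure_tensor f g | f g. f \<in> U \<and> g \<in> V}"

lemma lookup_pure_tensor [simp]:
  "Poly_Mapping.lookup (pure_tensor f g) (a, b) = Poly_Mapping.lookup f a * Poly_Mapping.lookup g b"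
  by transfer simp

lemma pure_tensor_bilinear:
  "pure_tensor (f + f') g = pure_tensor f g + pure_tensor f' g"
  "pure_tensor f (g + g') = pure_tensor f g + pure_tensor f g'"
  "pure_tensor (pm_scale c f) g = pm_scale c (pure_tensor f g)"
  "pure_tensor f (pm_scale c g) = pm_scale c (pure_tensor f g)"
  by (auto intro!: poly_mapping_eqI simp: lookup_add algebra_simps)

definition pm_lift :: "('k \<Rightarrow> 'w \<Rightarrow> 'w) \<Rightarrow> ('a \<Rightarrow> 'w) \<Rightarrow> ('a \<Rightarrow>\<^sub>0 'k::field) \<Rightarrow> 'w::ab_group_add" where
  "pm_lift s h t = (\<Sum>a\<in>Poly_Mapping.keys t. s (Poly_Mapping.lookup t a) (h a))"

lemma pm_lift_superset:
  assumes "vector_space s" "finite S" "Poly_Mapping.keys t \<subseteq> S"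
  shows "pm_lift s h t = (\<Sum>a\<in>S. s (Poly_Mapping.lookup t a) (h a))"
proof -
  interpret W: vector_space s by fact
  show ?thesis unfolding pm_lift_def
    by (rule sum.mono_neutral_left) (use assms in \<open>auto simp: in_keys_iff\<close>)
qed

lemma linear_pm_lift:
  assumes "vector_space (s :: 'k::field \<Rightarrow> 'w::ab_group_add \<Rightarrow> 'w)"
  shows "Vector_Spaces.linear pm_scale s (pm_lift s h)"
proof -
  interpret W: vector_space s by fact
  have "pm_lift s h (x + y) = pm_lift s h x + pm_lift s h y" for x y
  proof -
    have S: "finite (Poly_Mapping.keys x \<union> Poly_Mapping.keys y)" by simp
    show ?thesis
      using pm_lift_superset[OF assms S, of x h] pm_lift_superset[OF assms S, of y h]
        pm_lift_superset[OF assms S, of "x + y" h] Poly_Mapping.keys_add[of x y]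
      by (simp add: lookup_add W.scale_left_distrib sum.distrib)
  qed
  moreover have "pm_lift s h (pm_scale c x) = s c (pm_lift s h x)" for c x
  proof -
    have "Poly_Mapping.keys (pm_scale c x) \<subseteq> Poly_Mapping.keys x"
      by (auto simp: in_keys_iff)
    then show ?thesis
      using pm_lift_superset[OF assms, of "Poly_Mapping.keys x" "pm_scale c x" h]
      by (simp add: pm_lift_def W.scale_sum_right)
  qed
  ultimately show ?thesis
    using assms pm.vector_space_axioms by (auto simp: Vector_Spaces.linear_iff)
qed

lemma pm_expand:
  "(\<Sum>a\<in>Poly_Mapping.keys f. pm_scale (Poly_Mapping.lookup f a) (Poly_Mapping.single a 1)) = f"
  by (rule poly_mapping_eqI)
    (auto simp: lookup_sum lookup_single when_def in_keys_iff if_distrib cong: if_cong)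

lemma linear_expand:
  assumes "Vector_Spaces.linear pm_scale s F"
  shows "(\<Sum>a\<in>Poly_Mapping.keys f. s (Poly_Mapping.lookup f a) (F (Poly_Mapping.single a 1))) = F f"
proof -
  interpret F: Vector_Spaces.linear pm_scale s F by fact
  have "F f = F (\<Sum>a\<in>Poly_Mapping.keys f. pm_scale (Poly_Mapping.lookup f a) (Poly_Mapping.single a 1))"
    by (simp only: pm_expand)
  then show ?thesis by (simp add: F.sum F.scale)
qed

lemma tensor_space_universal:
  fixes s :: "'k::field \<Rightarrow> 'w::ab_group_add \<Rightarrow> 'w"
    and U :: "('a \<Rightarrow>\<^sub>0 'k) set" and V :: "('b \<Rightarrow>\<^sub>0 'k) set"
  assumes W: "vector_space s" and U: "pm.subspace U" and V: "pm.subspace V"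
    and left: "\<And>g. g \<in> V \<Longrightarrow> linear_map_on pm_scale s U (\<lambda>f. \<beta> f g)"
    and right: "\<And>f. f \<in> U \<Longrightarrow> linear_map_on pm_scale s V (\<beta> f)"
  shows "\<exists>!\<phi>. \<phi> \<in> extensional (tensor_space U V) \<and> linear_map_on pm_scale s (tensor_space U V) \<phi>
           \<and> (\<forall>f\<in>U. \<forall>g\<in>V. \<phi> (pure_tensor f g) = \<beta> f g)"
proof (rule ex_ex1I)
  interpret W: vector_space s by fact
  interpret AA: vector_space_pair "pm_scale :: 'k \<Rightarrow> ('a \<Rightarrow>\<^sub>0 'k) \<Rightarrow> _" "pm_scale :: 'k \<Rightarrow> ('a \<Rightarrow>\<^sub>0 'k) \<Rightarrow> _" ..
  interpret BB: vector_space_pair "pm_scale :: 'k \<Rightarrow> ('b \<Rightarrow>\<^sub>0 'k) \<Rightarrow> _" "pm_scale :: 'k \<Rightarrow> ('b \<Rightarrow>\<^sub>0 'k) \<Rightarrow> _" ..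
  obtain p where p: "range p \<subseteq> U" "Vector_Spaces.linear pm_scale pm_scale p" "\<forall>f\<in>U. p f = f"
    using AA.linear_exists_left_inverse_on[OF pm.linear_id U] by auto
  obtain q where q: "range q \<subseteq> V" "Vector_Spaces.linear pm_scale pm_scale q" "\<forall>g\<in>V. q g = g"
    using BB.linear_exists_left_inverse_on[OF pm.linear_id V] by auto
  define \<gamma> where "\<gamma> f g = \<beta> (p f) (q g)" for f g
  have pU: "p f \<in> U" and qV: "q g \<in> V" for f g using p(1) q(1) by auto
  have \<gamma>_left: "Vector_Spaces.linear pm_scale s (\<lambda>f. \<gamma> f g)" for g
    using W pm.vector_space_axioms left[OF qV] p(2) pU
    by (auto simp: \<gamma>_def Vector_Spaces.linear_iff linear_map_on_def)
  have \<gamma>_right: "Vector_Spaces.linear pm_scale s (\<gamma> f)" for f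
    using W pm.vector_space_axioms right[OF pU] q(2) qV
    by (auto simp: \<gamma>_def Vector_Spaces.linear_iff linear_map_on_def)
  define h where "h = (\<lambda>(a, b). \<gamma> (Poly_Mapping.single a 1) (Poly_Mapping.single b 1))"
  define \<Phi> where "\<Phi> = pm_lift s h"
  have lin: "Vector_Spaces.linear pm_scale s \<Phi>"
    unfolding \<Phi>_def by (rule linear_pm_lift[OF W])
  have val: "\<Phi> (pure_tensor f g) = \<gamma> f g" for f g
  proof -
    have "Poly_Mapping.keys (pure_tensor f g) \<subseteq> Poly_Mapping.keys f \<times> Poly_Mapping.keys g"
      by (auto simp: in_keys_iff)
    then have "\<Phi> (pure_tensor f g) = (\<Sum>x\<in>Poly_Mapping.keys f \<times> Poly_Mapping.keys g.
        s (Poly_Mapping.lookup (pure_tensor f g) x) (h x))"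
      unfolding \<Phi>_def by (intro pm_lift_superset[OF W]) auto
    also have "\<dots> = (\<Sum>a\<in>Poly_Mapping.keys f. \<Sum>b\<in>Poly_Mapping.keys g.
        s (Poly_Mapping.lookup (pure_tensor f g) (a, b)) (h (a, b)))"
      by (simp only: sum.cartesian_product) (auto intro!: sum.cong)
    also have "\<dots> = (\<Sum>a\<in>Poly_Mapping.keys f. s (Poly_Mapping.lookup f a)
        (\<Sum>b\<in>Poly_Mapping.keys g. s (Poly_Mapping.lookup g b)
          (\<gamma> (Poly_Mapping.single a 1) (Poly_Mapping.single b 1))))"
      by (simp add: h_def W.scale_sum_right)
    also have "\<dots> = (\<Sum>a\<in>Poly_Mapping.keys f. s (Poly_Mapping.lookup f a)
        (\<gamma> (Poly_Mapping.single a 1) g))"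
      by (simp add: linear_expand[OF \<gamma>_right])
    also have "\<dots> = \<gamma> f g"
      by (rule linear_expand[OF \<gamma>_left])
    finally show ?thesis .
  qed
  have sub: "pm.subspace (tensor_space U V)"
    unfolding tensor_space_def by (rule pm.subspace_span)
  show "\<exists>\<phi>. \<phi> \<in> extensional (tensor_space U V) \<and> linear_map_on pm_scale s (tensor_space U V) \<phi>
           \<and> (\<forall>f\<in>U. \<forall>g\<in>V. \<phi> (pure_tensor f g) = \<beta> f g)"
  proof (intro exI conjI)
    show "restrict \<Phi> (tensor_space U V) \<in> extensional (tensor_space U V)" by simp
    show "linear_map_on pm_scale s (tensor_space U V) (restrict \<Phi> (tensor_space U V))"
      using lin sub by (auto simp: linear_map_on_def Vector_Spaces.linear_iff
          pm.subspace_add pm.subspace_scale)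
    show "\<forall>f\<in>U. \<forall>g\<in>V. restrict \<Phi> (tensor_space U V) (pure_tensor f g) = \<beta> f g"
      using p(3) q(3) by (auto simp: val \<gamma>_def tensor_space_def intro!: pm.span_base)
  qed
  fix \<phi> \<psi>
  assume \<phi>: "\<phi> \<in> extensional (tensor_space U V) \<and> linear_map_on pm_scale s (tensor_space U V) \<phi>
           \<and> (\<forall>f\<in>U. \<forall>g\<in>V. \<phi> (pure_tensor f g) = \<beta> f g)"
    and \<psi>: "\<psi> \<in> extensional (tensor_space U V) \<and> linear_map_on pm_scale s (tensor_space U V) \<psi>
           \<and> (\<forall>f\<in>U. \<forall>g\<in>V. \<psi> (pure_tensor f g) = \<beta> f g)"
  have z: "\<chi> 0 = 0" if "linear_map_on pm_scale s (tensor_space U V) \<chi>" for \<chi>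
    using that pm.subspace_0[OF sub] unfolding linear_map_on_def by (metis pm.scale_zero_left W.scale_zero_left)
  have "x \<in> tensor_space U V \<and> \<phi> x = \<psi> x" if "x \<in> tensor_space U V" for x
    using that unfolding tensor_space_def
  proof (induction rule: pm.span_induct_alt)
    case base
    have "\<phi> 0 = 0" "\<psi> 0 = 0" using z \<phi> \<psi> by blast+
    then show ?case using pm.subspace_0[OF sub] by (simp add: tensor_space_def)
  next
    case (step c x y)
    have x: "x \<in> tensor_space U V" "\<phi> x = \<psi> x"
      using step(1) \<phi> \<psi> by (auto simp: tensor_space_def intro!: pm.span_base)
    have cx: "pm_scale c x \<in> tensor_space U V" using x sub pm.subspace_scale by blast
    show ?case
      using step(2) \<phi> \<psi> x cx sub unfolding linear_map_on_def tensor_space_def[symmetric]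
      by (auto simp: pm.subspace_add)
  qed
  then show "\<phi> = \<psi>" using \<phi> \<psi> by (metis extensionalityI)
qed

section \<open>Restricted growth words and bimodal decompositions\<close>

definition rg_word :: "nat list \<Rightarrow> bool" where
  "rg_word w \<longleftrightarrow> (\<forall>k\<in>set w. 1 \<le> k) \<and> (w \<noteq> [] \<longrightarrow> w ! 0 = 1) \<and>
     (\<forall>i. 0 < i \<and> i < length w \<longrightarrow> w ! i \<le> 1 + Max (set (take i w)))"

definition primary :: "nat list \<Rightarrow> bool" where
  "primary w \<longleftrightarrow> w \<noteq> [] \<and> rg_word w \<and> (\<forall>i. 0 < i \<and> i < length w \<longrightarrow> \<not> rg_word (drop i w))"

definition maximal_splitting :: "nat list \<Rightarrow> nat list list" where
  "maximal_splitting w = (THE ps. (\<forall>p\<in>set ps. primary p) \<and> concat ps = w)"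

lemma rg_word_take:
  assumes "rg_word w"
  shows "rg_word (take j w)"
  using assms unfolding rg_word_def by (auto simp: min_def dest: in_set_takeD)

lemma maximal_splitting_ex1:
  assumes "rg_word w"
  shows "\<exists>!ps. (\<forall>p\<in>set ps. primary p) \<and> concat ps = w"
proof (rule ex_ex1I)
  show "\<exists>ps. (\<forall>p\<in>set ps. primary p) \<and> concat ps = w"
    using assms
  proof (induction "length w" arbitrary: w rule: less_induct)
    case less
    show ?case
    proof (cases "w = []")
      case True
      then show ?thesis by (intro exI[of _ "[]"]) simp
    next
      case False
      define I where "I = {i. i < length w \<and> rg_word (drop i w)}"
      have I: "finite I" "0 \<in> I" using False less.prems by (auto simp: I_def)
      define j where "j = Max I"
      have j: "j \<in> I" "\<And>i. i \<in> I \<Longrightarrow> i \<le> j" using I by (auto simp: j_def intro: Max_in)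
      have prim: "primary (drop j w)"
        unfolding primary_def
      proof (intro conjI allI impI notI)
        fix i assume i: "0 < i \<and> i < length (drop j w)" "rg_word (drop i (drop j w))"
        then have "i + j \<in> I" by (auto simp: I_def add.commute)
        then show False using j(2) i by fastforce
      qed (use j(1) in \<open>auto simp: I_def\<close>)
      obtain ps where "\<forall>p\<in>set ps. primary p" "concat ps = take j w"
        using less.hyps[of "take j w"] rg_word_take[OF less.prems] j(1) by (auto simp: I_def)
      then show ?thesis using prim by (intro exI[of _ "ps @ [drop j w]"]) auto
    qed
  qed
  have suffix: "length q \<le> length p" if "u @ p = v @ q" "primary p" "primary q" for u v p q
  proof (rule ccontr)
    assume *: "\<not> length q \<le> length p"
    have "p = drop (length u) (v @ q)" using that(1) by (metis append_eq_conv_conj)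
    moreover have "length u + length p = length v + length q"
      using that(1) by (metis length_append)
    ultimately have p: "p = drop (length q - length p) q" using * by simp
    have "0 < length q - length p" "length q - length p < length q"
      using * that(2) by (auto simp: primary_def intro!: diff_less)
    then have "\<not> rg_word (drop (length q - length p) q)" using that(3) by (simp add: primary_def)
    then have "\<not> rg_word p" using arg_cong[OF p, of rg_word] by blast
    then show False using that(2) by (simp add: primary_def)
  qed
  show "ps = qs"
    if "(\<forall>p\<in>set ps. primary p) \<and> concat ps = w" "(\<forall>p\<in>set qs. primary p) \<and> concat qs = w"
    for ps qs
    using that
  proof (induction ps arbitrary: qs w rule: rev_induct)
    case Nil
    then show ?case by (cases qs) (auto simp: primary_def)
  next
    case (snoc p ps)
    show ?case
    proof (cases qs rule: rev_cases)
      case Nil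
      then show ?thesis using snoc.prems by (auto simp: primary_def)
    next
      case qs: (snoc qs' q)
      have e: "concat ps @ p = concat qs' @ q" "primary p" "primary q"
        using qs snoc.prems by auto
      have "length p = length q"
        using suffix[OF e] suffix[OF e(1)[symmetric] e(3,2)] by simp
      then have "p = q" "concat ps = concat qs'" using e by auto
      moreover have "ps = qs'"
        using qs snoc.prems \<open>concat ps = concat qs'\<close> by (intro snoc.IH[of "concat ps"]) auto
      ultimately show ?thesis using qs by simp
    qed
  qed
qed

definition is_partition :: "nat list \<Rightarrow> bool" where
  "is_partition \<mu> \<longleftrightarrow> sorted_wrt (\<ge>) \<mu> \<and> 0 \<notin> set \<mu>"

definition partition_word :: "nat list \<Rightarrow> nat list" where
  "partition_word \<mu> = concat (map (\<lambda>i. replicate (\<mu> ! i) (Suc i)) [0..<length \<mu>])"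

definition convex_word :: "nat list \<Rightarrow> bool" where
  "convex_word w \<longleftrightarrow> (\<exists>\<mu>. is_partition \<mu> \<and> w = partition_word \<mu>)"

fun bimodal_scan :: "nat list \<Rightarrow> nat list list \<Rightarrow> nat list list \<times> nat list" where
  "bimodal_scan acc [] = ([], acc)"
| "bimodal_scan acc (p # ps) =
     (if convex_word (acc @ p) then bimodal_scan (acc @ p) ps
      else let (fs, t) = bimodal_scan [] ps in ((acc @ p) # fs, t))"

definition bimodal_factors :: "nat list \<Rightarrow> nat list list" where
  "bimodal_factors w = fst (bimodal_scan [] (maximal_splitting w))"

definition bimodal_tail :: "nat list \<Rightarrow> nat list" where
  "bimodal_tail w = snd (bimodal_scan [] (maximal_splitting w))"

definition bimodal_word :: "nat list \<Rightarrow> bool" where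
  "bimodal_word w \<longleftrightarrow> rg_word w \<and>
     (\<exists>ps p. (\<forall>q\<in>set (ps @ [p]). primary q) \<and> w = concat (ps @ [p]) \<and>
        convex_word (concat ps) \<and> \<not> convex_word w)"

definition tail_free_words :: "nat \<Rightarrow> nat list set" where
  "tail_free_words n = {w. rg_word w \<and> set w \<subseteq> {1..n} \<and> bimodal_tail w = []}"

section \<open>Symmetric functions in noncommuting variables\<close>

definition monomial_type :: "nat list \<Rightarrow> nat set set" where
  "monomial_type z = {{i \<in> {1..length z}. z ! (i - 1) = x} | x. x \<in> set z}"

text \<open>The index set is finite: a word of type \<open>A\<close> has length \<open>card (\<Union>A)\<close>.\<close>

definition m_set :: "nat \<Rightarrow> nat set set \<Rightarrow> 'k::field_char_0 ncpoly" where
  "m_set n A = (\<Sum>z | set z \<subseteq> {1..n} \<and> monomial_type z = A. Poly_Mapping.single (Mon z) 1)"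

definition NCSym :: "nat \<Rightarrow> 'k::field_char_0 ncpoly set" where
  "NCSym n = pm.span {m_set n A | A d. partition_on {1..d} A}"

text \<open>The position of the block \<open>B\<close> when the blocks of \<open>A\<close> are listed by increasing minima.\<close>

definition block_index :: "nat set set \<Rightarrow> nat set \<Rightarrow> nat" where
  "block_index A B = card {C \<in> A. Min C \<le> Min B}"

definition growth_word :: "nat set set \<Rightarrow> nat list" where
  "growth_word A = map (\<lambda>i. block_index A (THE B. B \<in> A \<and> i \<in> B)) [1..<Suc (card (\<Union>A))]"

lemma rg_word_first_occurrence:
  assumes "rg_word w" "i < length w" "1 \<le> j" "j \<le> w ! i"
  shows "\<exists>i'\<le>i. w ! i' = j"
  using assms(2-)
proof (induction i rule: less_induct)
  case (less i)
  show ?case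
  proof (cases "j = w ! i")
    case False
    have "i \<noteq> 0"
    proof
      assume "i = 0"
      then show False using less.prems False assms(1) unfolding rg_word_def by (cases w) auto
    qed
    then have "w ! i \<le> 1 + Max (set (take i w))"
      using assms(1) less.prems unfolding rg_word_def by auto
    then have jM: "j \<le> Max (set (take i w))" using less.prems False by linarith
    have "Max (set (take i w)) \<in> set (take i w)"
      using \<open>i \<noteq> 0\<close> less.prems by (intro Max_in) auto
    then obtain k where "k < i" "w ! k = Max (set (take i w))"
      using less.prems by (auto simp: in_set_conv_nth)
    then have "\<exists>i'\<le>k. w ! i' = j" using less.IH[of k] jM less.prems by simp
    then obtain i' where "i' \<le> k" "w ! i' = j" by blast
    then show ?thesis using \<open>k < i\<close> by (intro exI[of _ i']) simp
  qed auto
qed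

text \<open>\<open>growth_word\<close> is a bijection onto the restricted growth words, inverse to \<open>monomial_type\<close>.\<close>

lemma growth_word_inverse:
  assumes "rg_word w"
  shows "partition_on {1..length w} (monomial_type w)" "growth_word (monomial_type w) = w"
proof -
  define S where "S k = {i \<in> {1..length w}. w ! (i - 1) = k}" for k
  have T: "monomial_type w = S ` set w" by (auto simp: monomial_type_def S_def)
  have fin: "finite (S k)" for k by (simp add: S_def)
  have mem: "i \<in> S k \<longleftrightarrow> i \<in> {1..length w} \<and> w ! (i - 1) = k" for i k by (simp add: S_def)
  have ne: "S k \<noteq> {}" if kw: "k \<in> set w" for k
  proof -
    obtain i where "i < length w" "w ! i = k" using kw by (auto simp: in_set_conv_nth)
    then have "Suc i \<in> S k" by (simp add: S_def)
    then show ?thesis by blast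
  qed
  have letter: "w ! (i - 1) \<in> set w" if "i \<in> {1..length w}" for i
    using that by (intro nth_mem) auto
  show P: "partition_on {1..length w} (monomial_type w)"
    unfolding T using ne letter by (intro partition_onI) (auto simp: mem disjnt_def)
  have less: "Min (S j) < Min (S k)" and inw: "j \<in> set w" if "1 \<le> j" "j < k" "k \<in> set w" for j k
  proof -
    define i where "i = Min (S k)"
    have i: "i \<in> {1..length w}" "w ! (i - 1) = k"
      using Min_in[OF fin ne[OF that(3)]] by (auto simp: i_def mem)
    then have "\<exists>i'\<le>i - 1. w ! i' = j"
      using that by (intro rg_word_first_occurrence[OF assms]) auto
    then obtain i' where i': "i' \<le> i - 1" "w ! i' = j" by blast
    then have "i' < i - 1" using i that by (cases "i' = i - 1") auto
    then have "Suc i' \<in> S j" "Suc i' < i" using i i' by (auto simp: mem)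
    then show "Min (S j) < Min (S k)" using Min_le[OF fin, of "Suc i'" j] by (simp add: i_def)
    have "i' < length w" using i \<open>i' < i - 1\<close> by auto
    then show "j \<in> set w" using i'(2) nth_mem by blast
  qed
  have pos: "1 \<le> k" if "k \<in> set w" for k using assms that unfolding rg_word_def by blast
  have idx: "block_index (monomial_type w) (S k) = k" if k: "k \<in> set w" for k
  proof -
    have sub: "{1..k} \<subseteq> set w"
    proof
      fix j assume "j \<in> {1..k}"
      then show "j \<in> set w" using inw[of j k] k by (cases "j = k") auto
    qed
    have "{C \<in> monomial_type w. Min C \<le> Min (S k)} = S ` {1..k}"
    proof (intro equalityI subsetI)
      fix C assume "C \<in> {C \<in> monomial_type w. Min C \<le> Min (S k)}"
      then obtain j where j: "j \<in> set w" "C = S j" "Min (S j) \<le> Min (S k)" by (auto simp: T)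
      then have "j \<le> k" using less[of k j] pos k by (meson leI not_less)
      then show "C \<in> S ` {1..k}" using j pos by auto
    next
      fix C assume "C \<in> S ` {1..k}"
      then obtain j where j: "1 \<le> j" "j \<le> k" "C = S j" by auto
      then have "Min (S j) \<le> Min (S k)" using less[of j k] k by (cases "j = k") auto
      then show "C \<in> {C \<in> monomial_type w. Min C \<le> Min (S k)}" using j sub by (auto simp: T)
    qed
    moreover have "inj_on S {1..k}"
    proof (rule inj_onI)
      fix a b assume ab: "a \<in> {1..k}" "b \<in> {1..k}" "S a = S b"
      then have "a \<in> set w" using sub by blast
      then obtain i where "i \<in> S a" using ne[of a] by (metis ex_in_conv)
      then have "i \<in> S a" "i \<in> S b" using ab(3) by blast+
      then show "a = b" unfolding mem by blast
    qed
    ultimately show ?thesis by (simp add: block_index_def card_image)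
  qed
  have U: "\<Union>(monomial_type w) = {1..length w}" using P by (simp add: partition_on_def)
  have the: "(THE B. B \<in> monomial_type w \<and> i \<in> B) = S (w ! (i - 1))" if "i \<in> {1..length w}" for i
    using that letter by (intro the_equality) (auto simp: T mem)
  show "growth_word (monomial_type w) = w"
    unfolding growth_word_def U
  proof (rule nth_equalityI)
    fix i assume "i < length (map (\<lambda>i. block_index (monomial_type w)
        (THE B. B \<in> monomial_type w \<and> i \<in> B)) [1..<Suc (card {1..length w})])"
    then have i: "i < length w" by (simp del: upt_Suc)
    then have u: "i < length [1..<Suc (card {1..length w})]" "[1..<Suc (card {1..length w})] ! i = Suc i"
      by (simp_all del: upt_Suc)
    have B: "(THE B. B \<in> monomial_type w \<and> Suc i \<in> B) = S (w ! i)"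
      using the[of "Suc i"] i by simp
    show "map (\<lambda>i. block_index (monomial_type w) (THE B. B \<in> monomial_type w \<and> i \<in> B))
        [1..<Suc (card {1..length w})] ! i = w ! i"
      unfolding nth_map[OF u(1)] u(2) B by (rule idx[OF nth_mem[OF i]])
  qed (simp del: upt_Suc)
qed

lemma monomial_type_growth_word:
  assumes P: "partition_on {1..d} A"
  shows "monomial_type (growth_word A) = A"
proof -
  have U: "\<Union>A = {1..d}" and dis: "disjoint A" and ne: "{} \<notin> A"
    using P by (auto simp: partition_on_def)
  have finA: "finite A" using U by (intro finite_UnionD) simp
  have fin: "finite B" if "B \<in> A" for B 
    using Union_upper[OF that] U by (intro finite_subset[of B "{1..d}"]) simp_all
  have minj: "B = C" if "B \<in> A" "C \<in> A" "Min B = Min C" for B C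
    
  proof (rule ccontr)
    assume "B \<noteq> C"
    then have "disjnt B C" using that dis by (auto dest: pairwiseD)
    moreover have "Min B \<in> B" "Min C \<in> C" using that ne fin Min_in by blast+
    ultimately show False using that(3) by (auto simp: disjnt_iff)
  qed
  have binj: "B = C" if "B \<in> A" "C \<in> A" "block_index A B = block_index A C" for B C
  proof (rule ccontr)
    assume "B \<noteq> C"
    have aux: "block_index A X < block_index A Y" if "X \<in> A" "Y \<in> A" "Min X < Min Y" for X Y
    proof -
      have "Y \<in> {C \<in> A. Min C \<le> Min Y} - {C \<in> A. Min C \<le> Min X}" using that by auto
      then have "{C \<in> A. Min C \<le> Min X} \<subset> {C \<in> A. Min C \<le> Min Y}" using that by fastforce
      then show ?thesis unfolding block_index_def using finA by (intro psubset_card_mono) auto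
    qed
    have "Min B \<noteq> Min C" using minj that \<open>B \<noteq> C\<close> by blast
    then consider "Min B < Min C" | "Min C < Min B" by linarith
    then show False using aux[of B C] aux[of C B] that by cases auto
  qed
  have the: "(THE B. B \<in> A \<and> i \<in> B) = B" if "B \<in> A" "i \<in> B" for i B
    using that dis by (intro the_equality) (auto simp: disjnt_iff dest: pairwiseD)
  have len: "length (growth_word A) = d" by (simp add: growth_word_def U)
  have nth: "growth_word A ! (i - 1) = block_index A B" if "B \<in> A" "i \<in> B" for i B
  proof -
    have "i \<in> {1..d}" using that U by blast
    then have i: "i - 1 < length [1..<Suc d]" "[1..<Suc d] ! (i - 1) = i"
      by (auto simp del: upt_Suc)
    show ?thesis
      unfolding growth_word_def U card_atLeastAtMost diff_Suc_1 nth_map[OF i(1)] i(2) the[OF that] ..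
  qed
  have fib: "{i \<in> {1..d}. growth_word A ! (i - 1) = block_index A B} = B" if B: "B \<in> A" for B
  proof (intro equalityI subsetI)
    fix i assume i: "i \<in> {i \<in> {1..d}. growth_word A ! (i - 1) = block_index A B}"
    then obtain C where "C \<in> A" "i \<in> C" using U by blast
    then show "i \<in> B" using nth binj B i by auto
  next
    fix i assume "i \<in> B"
    then show "i \<in> {i \<in> {1..d}. growth_word A ! (i - 1) = block_index A B}" using nth B U by auto
  qed
  have "set (growth_word A) = block_index A ` A"
  proof -
    have "set (growth_word A) = (\<lambda>i. block_index A (THE B. B \<in> A \<and> i \<in> B)) ` {1..d}"
      by (auto simp: growth_word_def U simp del: upt_Suc)
    also have "\<dots> = block_index A ` A"
    proof (intro equalityI subsetI)
      fix k assume "k \<in> (\<lambda>i. block_index A (THE B. B \<in> A \<and> i \<in> B)) ` {1..d}"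
      then obtain i where "i \<in> {1..d}" "k = block_index A (THE B. B \<in> A \<and> i \<in> B)" by auto
      moreover from this obtain B where "B \<in> A" "i \<in> B" using U by blast
      ultimately show "k \<in> block_index A ` A" using the by auto
    next
      fix k assume "k \<in> block_index A ` A"
      then obtain B where B: "B \<in> A" "k = block_index A B" by auto
      then obtain i where "i \<in> B" using ne by (metis ex_in_conv)
      then show "k \<in> (\<lambda>i. block_index A (THE B. B \<in> A \<and> i \<in> B)) ` {1..d}"
        using B the U by (intro image_eqI[of _ _ i]) auto
    qed
    finally show ?thesis .
  qed
  then have "monomial_type (growth_word A) =
      (\<lambda>B. {i \<in> {1..d}. growth_word A ! (i - 1) = block_index A B}) ` A"
    by (auto simp: monomial_type_def len)
  then show ?thesis using fib by simp
qed

definition m_word :: "nat \<Rightarrow> nat list \<Rightarrow> 'k::field_char_0 ncpoly" where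
  "m_word n w = m_set n (THE A. partition_on {1..length w} A \<and> growth_word A = w)"

lemma m_word_eq:
  assumes "rg_word w"
  shows "m_word n w = m_set n (monomial_type w)"
proof -
  have "(THE A. partition_on {1..length w} A \<and> growth_word A = w) = monomial_type w"
    using growth_word_inverse[OF assms] monomial_type_growth_word by (intro the_equality) blast+
  then show ?thesis by (simp add: m_word_def)
qed

definition shape :: "nat set set \<Rightarrow> nat list" where
  "shape A = rev (sorted_list_of_multiset (image_mset card (mset_set A)))"

definition set_partitions_of_shape :: "nat list \<Rightarrow> nat set set set" where
  "set_partitions_of_shape \<mu> = {A. partition_on {1..sum_list \<mu>} A \<and> shape A = \<mu>}"

definition NCSym_shape :: "nat \<Rightarrow> nat list \<Rightarrow> 'k::field_char_0 ncpoly set" where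
  "NCSym_shape n \<mu> = pm.span (m_set n ` set_partitions_of_shape \<mu>)"

definition m_part :: "nat \<Rightarrow> nat list \<Rightarrow> 'k::field_char_0 ncpoly" where
  "m_part n \<mu> =
     pm_scale (1 / (of_nat (pm.dim (NCSym_shape n \<mu> :: 'k ncpoly set)) *
                    (\<Prod>i\<in>set \<mu>. fact (count_list \<mu> i))))
       (\<Sum>A\<in>set_partitions_of_shape \<mu>. m_set n A)"

definition partitions_upto :: "nat \<Rightarrow> nat list set" where
  "partitions_upto n = {\<mu>. is_partition \<mu> \<and> length \<mu> \<le> n}"

definition Lambda_space :: "nat \<Rightarrow> 'k::field_char_0 ncpoly set" where
  "Lambda_space n = pm.span (m_part n ` partitions_upto n)"

definition C_algebra :: "nat \<Rightarrow> 'k::field_char_0 ncpoly set" where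
  "C_algebra n = subalgebra hull {m_word n v | v. bimodal_word v}"

definition bimodal_product :: "nat \<Rightarrow> nat list \<Rightarrow> 'k::field_char_0 ncpoly" where
  "bimodal_product n w = prod_list (map (m_word n) (bimodal_factors w))"

text \<open>
  The conditions that define \<open>\<phi>\<close>. For a tail-free word \<open>w\<close> the concatenation of its bimodal
  factors is written out rather than replaced by \<open>w\<close>.
\<close>

definition is_phi ::
    "nat \<Rightarrow> ((monomial \<times> monomial \<Rightarrow>\<^sub>0 'k::field_char_0) \<Rightarrow> 'k ncpoly) \<Rightarrow> bool" where
  "is_phi n \<phi> \<longleftrightarrow>
     linear_map_on pm_scale pm_scale (tensor_space (C_algebra n) (Lambda_space n)) \<phi> \<and>
     (\<forall>w\<in>tail_free_words n. \<forall>\<mu>\<in>partitions_upto n.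
        \<phi> (pure_tensor (bimodal_product n w) (m_part n \<mu>)) =
          m_word n (concat (bimodal_factors w) @ partition_word \<mu>))"

end

theory Submission
  imports Defs
begin

text \<open>
  A word with the same type as a restricted growth word \<open>v\<close> is either \<open>v\<close> or lexicographically
  larger, because \<open>v\<close> always introduces the smallest letter not used so far. Hence the product
  \<open>m\<^sub>v\<^sub>1 \<cdots> m\<^sub>v\<^sub>r\<close> has the lexicographically smallest word \<open>v\<^sub>1 \<cdots> v\<^sub>r\<close>, with coefficient 1,
  among its monomials. A word is recovered from its bimodal factors and any sequence of bimodal words
  is the bimodal decomposition of its concatenation, so the products of bimodal generators
  are unitriangular and form a basis of the algebra they generate. Finally, \<open>w \<mapsto> (factors, tail)\<close>
  identifies all restricted growth words with pairs of a tail-free word and a partition,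
  so \<open>\<phi>\<close> maps a basis bijectively onto a basis.
\<close>

section \<open>Bases given by families\<close>

lemma basis_family_iff:
  fixes b :: "'i \<Rightarrow> ('a \<Rightarrow>\<^sub>0 'k::field)"
  shows "basis_family I b V \<longleftrightarrow>
    (\<forall>F c. finite F \<longrightarrow> F \<subseteq> I \<longrightarrow> (\<Sum>i\<in>F. pm_scale (c i) (b i)) = 0 \<longrightarrow> (\<forall>i\<in>F. c i = 0)) \<and>
    pm.span (b ` I) = V"
    (is "_ \<longleftrightarrow> ?indep \<and> _")
proof -
  have "inj_on b I \<and> pm.independent (b ` I)" if ?indep
  proof
    show inj: "inj_on b I"
    proof (rule inj_onI, rule ccontr)
      fix i j assume ij: "i \<in> I" "j \<in> I" "b i = b j" "i \<noteq> j"
      have "(\<Sum>k\<in>{i, j}. pm_scale (if k = i then 1 else - 1) (b k)) = 0"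
        using ij by simp
      then have "\<forall>k\<in>{i, j}. (if k = i then 1 else - 1) = (0::'k)"
        using that[rule_format, of "{i, j}" "\<lambda>k. if k = i then 1 else - 1"] ij by blast
      then show False by simp
    qed
    show "pm.independent (b ` I)"
      unfolding pm.independent_explicit_finite_subsets
    proof (intro allI impI)
      fix S u assume S: "S \<subseteq> b ` I" "finite S" "(\<Sum>v\<in>S. pm_scale (u v) v) = 0"
      then obtain F where F: "F \<subseteq> I" "finite F" "S = b ` F" by (meson finite_subset_image)
      have "inj_on b F" using inj F(1) by (rule inj_on_subset)
      then have "(\<Sum>i\<in>F. pm_scale (u (b i)) (b i)) = 0"
        using S(3) by (simp add: F(3) sum.reindex)
      then have "\<forall>i\<in>F. u (b i) = 0" using that[rule_format, of F "\<lambda>i. u (b i)"] F by blast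
      then show "\<forall>v\<in>S. u v = 0" by (simp add: F(3))
    qed
  qed
  moreover have ?indep if "inj_on b I" "pm.independent (b ` I)"
  proof (intro allI impI)
    fix F c assume F: "finite F" "F \<subseteq> I" "(\<Sum>i\<in>F. pm_scale (c i) (b i)) = 0"
    have inj: "inj_on b F" using that(1) F(2) by (rule inj_on_subset)
    have "(\<Sum>v\<in>b ` F. pm_scale (c (inv_into F b v)) v) = 0"
      using F(3) inj by (simp add: sum.reindex)
    then have "\<forall>v\<in>b ` F. c (inv_into F b v) = 0"
      using that(2)[unfolded pm.independent_explicit_finite_subsets, rule_format,
          of "b ` F" "\<lambda>v. c (inv_into F b v)"] F by blast
    then show "\<forall>i\<in>F. c i = 0" using inj by simp
  qed
  ultimately show ?thesis unfolding basis_family_def by blast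
qed

lemma triangular_basis_family:
  fixes b :: "'i \<Rightarrow> ('a \<Rightarrow>\<^sub>0 'k::field)"
  assumes wf: "wf R"
    and lead: "\<And>i. i \<in> I \<Longrightarrow> Poly_Mapping.lookup (b i) (key i) \<noteq> 0"
    and tri: "\<And>i j. i \<in> I \<Longrightarrow> j \<in> I \<Longrightarrow> Poly_Mapping.lookup (b j) (key i) \<noteq> 0 \<Longrightarrow> i \<noteq> j \<Longrightarrow> (j, i) \<in> R"
  shows "basis_family I b (pm.span (b ` I))"
  unfolding basis_family_iff
proof (intro conjI allI impI ballI refl, rule ccontr)
  fix F c i
  assume F: "finite F" "F \<subseteq> I" "(\<Sum>i\<in>F. pm_scale (c i) (b i)) = 0" and i: "i \<in> F" "c i \<noteq> 0"
  then obtain m where m: "m \<in> {i \<in> F. c i \<noteq> 0}" "\<And>j. (j, m) \<in> R \<Longrightarrow> j \<notin> {i \<in> F. c i \<noteq> 0}"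
    using wfE_min[OF wf, of i "{i \<in> F. c i \<noteq> 0}"] by auto
  have "0 = Poly_Mapping.lookup (\<Sum>i\<in>F. pm_scale (c i) (b i)) (key m)" using F(3) by simp
  also have "\<dots> = (\<Sum>i\<in>F. c i * Poly_Mapping.lookup (b i) (key m))" by (simp add: lookup_sum)
  also have "\<dots> = (\<Sum>i\<in>{m}. c i * Poly_Mapping.lookup (b i) (key m))"
    using F(1,2) m tri[of m] by (intro sum.mono_neutral_right) auto
  finally show False using m(1) lead F(2) by auto
qed

lemma basis_family_reindex:
  assumes "basis_family K b V" "bij_betw g I K"
  shows "basis_family I (\<lambda>i. b (g i)) V"
proof -
  have "(\<lambda>i. b (g i)) ` I = b ` K" using assms(2) by (auto simp: bij_betw_def)
  moreover have "inj_on (\<lambda>i. b (g i)) I"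
    using assms by (auto simp: basis_family_def bij_betw_def inj_on_def)
  ultimately show ?thesis using assms(1) by (simp add: basis_family_def)
qed

lemma basis_family_pure_tensor:
  fixes b :: "'i \<Rightarrow> ('a \<Rightarrow>\<^sub>0 'k::field)" and b' :: "'j \<Rightarrow> ('c \<Rightarrow>\<^sub>0 'k)"
  assumes U: "basis_family I b U" and V: "basis_family J b' V"
  shows "basis_family (I \<times> J) (\<lambda>(i, j). pure_tensor (b i) (b' j)) (tensor_space U V)"
  unfolding basis_family_iff
proof (intro conjI allI impI)
  fix F c
  assume F: "finite F" "F \<subseteq> I \<times> J"
    and sum0: "(\<Sum>p\<in>F. pm_scale (c p) (case p of (i, j) \<Rightarrow> pure_tensor (b i) (b' j))) = 0"
  define d where "d p = (if p \<in> F then c p else 0)" for p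
  define A where "A = fst ` F"
  define B where "B = snd ` F"
  have fin: "finite A" "finite B" and sub: "A \<subseteq> I" "B \<subseteq> J" "F \<subseteq> A \<times> B"
    using F by (force simp: A_def B_def)+
  have row: "(\<Sum>j\<in>B. d (i, j) * Poly_Mapping.lookup (b' j) y) = 0" if "i \<in> A" for i y
  proof -
    have "(\<Sum>i\<in>A. pm_scale (\<Sum>j\<in>B. d (i, j) * Poly_Mapping.lookup (b' j) y) (b i)) = 0"
    proof (rule poly_mapping_eqI)
      fix x
      have "0 = Poly_Mapping.lookup
          (\<Sum>p\<in>F. pm_scale (c p) (case p of (i, j) \<Rightarrow> pure_tensor (b i) (b' j))) (x, y)"
        using sum0 by simp
      also have "\<dots> = (\<Sum>p\<in>F. c p * (case p of (i, j) \<Rightarrow>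
          Poly_Mapping.lookup (b i) x * Poly_Mapping.lookup (b' j) y))"
        by (auto simp: lookup_sum intro!: sum.cong)
      also have "\<dots> = (\<Sum>p\<in>A \<times> B. d p * (case p of (i, j) \<Rightarrow>
          Poly_Mapping.lookup (b i) x * Poly_Mapping.lookup (b' j) y))"
        using fin sub(3) by (intro sum.mono_neutral_cong_left) (auto simp: d_def)
      also have "\<dots> = (\<Sum>i\<in>A. \<Sum>j\<in>B. d (i, j) *
          (Poly_Mapping.lookup (b i) x * Poly_Mapping.lookup (b' j) y))"
        by (simp only: sum.cartesian_product) (auto intro!: sum.cong)
      also have "\<dots> = Poly_Mapping.lookup
          (\<Sum>i\<in>A. pm_scale (\<Sum>j\<in>B. d (i, j) * Poly_Mapping.lookup (b' j) y) (b i)) x"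
        by (simp add: lookup_sum sum_distrib_left mult_ac)
      finally show "Poly_Mapping.lookup
          (\<Sum>i\<in>A. pm_scale (\<Sum>j\<in>B. d (i, j) * Poly_Mapping.lookup (b' j) y) (b i)) x
          = Poly_Mapping.lookup 0 x" by simp
    qed
    then show ?thesis
      using U[unfolded basis_family_iff, THEN conjunct1, rule_format, of A
          "\<lambda>i. \<Sum>j\<in>B. d (i, j) * Poly_Mapping.lookup (b' j) y"] fin(1) sub(1) that by blast
  qed
  have "d (i, j) = 0" if "i \<in> A" "j \<in> B" for i j
  proof -
    have "(\<Sum>j\<in>B. pm_scale (d (i, j)) (b' j)) = 0"
      by (rule poly_mapping_eqI) (simp add: lookup_sum row[OF that(1)])
    then show ?thesis
      using V[unfolded basis_family_iff, THEN conjunct1, rule_format, of B "\<lambda>j. d (i, j)"]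
        fin(2) sub(2) that(2) by blast
  qed
  then have "d p = 0" if "p \<in> F" for p using that sub(3) by blast
  then show "\<forall>p\<in>F. c p = 0" by (simp add: d_def)
next
  let ?T = "pm.span ((\<lambda>(i, j). pure_tensor (b i) (b' j)) ` (I \<times> J))"
  have zero: "pure_tensor 0 g = 0" "pure_tensor f 0 = 0"
    for f :: "'a \<Rightarrow>\<^sub>0 'k" and g :: "'c \<Rightarrow>\<^sub>0 'k"
    by (auto intro!: poly_mapping_eqI)
  have spanU: "pm.span (b ` I) = U" and spanV: "pm.span (b' ` J) = V"
    using U V by (auto simp: basis_family_def)
  have gen: "pure_tensor (b i) g \<in> ?T" if "i \<in> I" "g \<in> pm.span (b' ` J)" for i g
    using that(2)
  proof (induction rule: pm.span_induct_alt)
    case base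
    show ?case by (simp add: zero pm.span_zero)
  next
    case (step c x y)
    then obtain j where "j \<in> J" "x = b' j" by auto
    then have "pure_tensor (b i) x \<in> ?T" using that(1) by (auto intro!: pm.span_base)
    then show ?case using step.IH by (simp add: pure_tensor_bilinear pm.span_add pm.span_scale)
  qed
  have "pure_tensor f g \<in> ?T" if "f \<in> pm.span (b ` I)" "g \<in> pm.span (b' ` J)" for f g
    using that(1)
  proof (induction rule: pm.span_induct_alt)
    case base
    show ?case by (simp add: zero pm.span_zero)
  next
    case (step c x y)
    then have "pure_tensor x g \<in> ?T" using gen that(2) by auto
    then show ?case using step.IH by (simp add: pure_tensor_bilinear pm.span_add pm.span_scale)
  qed
  then have "tensor_space U V \<subseteq> ?T"
    unfolding tensor_space_def spanU spanV by (intro pm.span_minimal) auto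
  moreover have "b i \<in> U" "b' j \<in> V" if "i \<in> I" "j \<in> J" for i j
    using that spanU spanV by (auto intro: pm.span_base)
  then have "?T \<subseteq> tensor_space U V"
    unfolding tensor_space_def by (intro pm.span_mono) fast
  ultimately show "?T = tensor_space U V" by blast
qed

lemma linear_map_on_basis_family:
  fixes b :: "'i \<Rightarrow> ('a \<Rightarrow>\<^sub>0 'k::field)" and b' :: "'i \<Rightarrow> ('c \<Rightarrow>\<^sub>0 'k)"
  assumes U: "basis_family I b U" and V: "basis_family I b' V"
  shows "\<exists>!\<phi>. \<phi> \<in> extensional U \<and> linear_map_on pm_scale pm_scale U \<phi> \<and> (\<forall>i\<in>I. \<phi> (b i) = b' i)"
    and "linear_map_on pm_scale pm_scale U \<phi> \<Longrightarrow> \<forall>i\<in>I. \<phi> (b i) = b' i \<Longrightarrow> bij_betw \<phi> U V"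
proof -
  interpret P: vector_space_pair "pm_scale :: 'k \<Rightarrow> ('a \<Rightarrow>\<^sub>0 'k) \<Rightarrow> _"
    "pm_scale :: 'k \<Rightarrow> ('c \<Rightarrow>\<^sub>0 'k) \<Rightarrow> _" ..
  have inj: "inj_on b I" and ind: "pm.independent (b ` I)" and spanU: "pm.span (b ` I) = U"
    and inj': "inj_on b' I" and ind': "pm.independent (b' ` I)" and spanV: "pm.span (b' ` I) = V"
    using U V by (auto simp: basis_family_def)
  obtain \<Phi> where \<Phi>: "Vector_Spaces.linear pm_scale pm_scale \<Phi>"
      "\<forall>x\<in>b ` I. \<Phi> x = b' (inv_into I b x)"
    using P.linear_independent_extend[OF ind, of "\<lambda>x. b' (inv_into I b x)"] by blast
  interpret \<Phi>: Vector_Spaces.linear pm_scale pm_scale \<Phi> by fact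
  have \<Phi>b: "\<Phi> (b i) = b' i" if "i \<in> I" for i using that \<Phi>(2) inj by simp
  have img: "\<Phi> ` b ` I = b' ` I" using \<Phi>b by (auto simp: image_iff)
  have sub: "pm.subspace U" unfolding spanU[symmetric] by (rule pm.subspace_span)
  have lin: "linear_map_on pm_scale pm_scale U \<Phi>"
    by (simp add: linear_map_on_def \<Phi>.add \<Phi>.scale)
  have eq: "\<psi> x = \<Phi> x"
    if \<psi>: "linear_map_on pm_scale pm_scale U \<psi>" "\<forall>i\<in>I. \<psi> (b i) = b' i" and x: "x \<in> U" for \<psi> x
  proof -
    have "x \<in> U \<and> \<psi> x = \<Phi> x" using x unfolding spanU[symmetric]
    proof (induction rule: pm.span_induct_alt)
      case base
      have "\<psi> (pm_scale 0 0) = pm_scale 0 (\<psi> 0)"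
        using \<psi>(1) pm.subspace_0[OF sub] unfolding linear_map_on_def by blast
      then show ?case using pm.subspace_0[OF sub] by (simp add: spanU \<Phi>.zero)
    next
      case (step c x y)
      then have "x \<in> U" "\<psi> x = \<Phi> x" using \<psi>(2) \<Phi>b spanU by (auto intro: pm.span_base)
      then show ?case
        using step.IH \<psi>(1) sub unfolding spanU linear_map_on_def
        by (auto simp: pm.subspace_add pm.subspace_scale \<Phi>.add \<Phi>.scale)
    qed
    then show ?thesis ..
  qed
  show "\<exists>!\<phi>. \<phi> \<in> extensional U \<and> linear_map_on pm_scale pm_scale U \<phi> \<and> (\<forall>i\<in>I. \<phi> (b i) = b' i)"
  proof (rule ex1I)
    show "restrict \<Phi> U \<in> extensional U \<and> linear_map_on pm_scale pm_scale U (restrict \<Phi> U) \<and>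
        (\<forall>i\<in>I. restrict \<Phi> U (b i) = b' i)"
      using lin sub \<Phi>b spanU
      by (auto simp: linear_map_on_def pm.subspace_add pm.subspace_scale intro: pm.span_base)
    fix \<psi>
    assume "\<psi> \<in> extensional U \<and> linear_map_on pm_scale pm_scale U \<psi> \<and> (\<forall>i\<in>I. \<psi> (b i) = b' i)"
    then show "\<psi> = restrict \<Phi> U"
      using eq by (intro extensionalityI[of _ U]) auto
  qed
  assume \<phi>: "linear_map_on pm_scale pm_scale U \<phi>" "\<forall>i\<in>I. \<phi> (b i) = b' i"
  have "inj_on \<Phi> (b ` I)" using inj' \<Phi>b by (auto simp: inj_on_def)
  then have "inj_on \<Phi> U"
    using \<Phi>.inj_on_span_independent_image[of "b ` I"] ind' unfolding img spanU by blast
  moreover have "\<Phi> ` U = V" using \<Phi>.span_image[of "b ` I"] unfolding img spanU spanV by simp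
  ultimately have "bij_betw \<Phi> U V" by (simp add: bij_betw_def)
  then show "bij_betw \<phi> U V" using eq[OF \<phi>] by (simp cong: bij_betw_cong)
qed

section \<open>Combinatorics of restricted growth words\<close>

lemma rg_word_Nil [simp]: "rg_word []"
  by (simp add: rg_word_def)

lemma rg_word_snoc:
  "rg_word (w @ [k]) \<longleftrightarrow> rg_word w \<and> 1 \<le> k \<and> k \<le> Suc (Max (insert 0 (set w)))"
proof (cases "w = []")
  case True
  then show ?thesis by (auto simp: rg_word_def)
next
  case False
  then have "Max (insert 0 (set w)) = Max (set w)" by simp
  moreover have "rg_word w \<and> 1 \<le> k \<and> k \<le> Suc (Max (set w))" if "rg_word (w @ [k])"
  proof -
    have "rg_word w" using rg_word_take[OF that, of "length w"] by simp
    moreover have "k \<le> Suc (Max (set w))"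
      using that False unfolding rg_word_def
      by (auto dest!: spec[of _ "length w"])
    ultimately show ?thesis using that by (simp add: rg_word_def)
  qed
  moreover have "rg_word (w @ [k])" if "rg_word w" "1 \<le> k" "k \<le> Suc (Max (set w))"
    using that False unfolding rg_word_def by (auto simp: nth_append less_Suc_eq)
  ultimately show ?thesis by auto
qed

lemma rg_word_append:
  assumes "rg_word u" "rg_word v"
  shows "rg_word (u @ v)"
  using assms(2)
proof (induction v rule: rev_induct)
  case Nil
  then show ?case using assms(1) by simp
next
  case (snoc k v)
  have "Max (insert 0 (set v)) \<le> Max (insert 0 (set (u @ v)))" by (intro Max_mono) auto
  then show ?case using snoc unfolding append_assoc[symmetric] rg_word_snoc by (meson Suc_le_mono le_trans)
qed

lemma rg_word_concat: "(\<And>p. p \<in> set ps \<Longrightarrow> rg_word p) \<Longrightarrow> rg_word (concat ps)"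
  by (induction ps) (auto intro: rg_word_append)

lemma maximal_splitting_concat:
  assumes "\<forall>p\<in>set ps. primary p"
  shows "maximal_splitting (concat ps) = ps"
proof -
  have "rg_word (concat ps)" using assms by (intro rg_word_concat) (auto simp: primary_def)
  from the1_equality[OF maximal_splitting_ex1[OF this]] assms show ?thesis
    unfolding maximal_splitting_def by blast
qed

lemma maximal_splitting:
  assumes "rg_word w"
  shows "\<forall>p\<in>set (maximal_splitting w). primary p" "concat (maximal_splitting w) = w"
  using theI'[OF maximal_splitting_ex1[OF assms]] unfolding maximal_splitting_def by auto

lemma partition_word_Nil [simp]: "partition_word [] = []"
  by (simp add: partition_word_def)

lemma partition_word_snoc:
  "partition_word (\<mu> @ [a]) = partition_word \<mu> @ replicate a (Suc (length \<mu>))"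
proof -
  have "map (\<lambda>i. replicate ((\<mu> @ [a]) ! i) (Suc i)) [0..<length \<mu>] =
      map (\<lambda>i. replicate (\<mu> ! i) (Suc i)) [0..<length \<mu>]"
    by (simp add: nth_append)
  then have "concat (map (\<lambda>i. replicate ((\<mu> @ [a]) ! i) (Suc i)) [0..<length \<mu>]) = partition_word \<mu>"
    unfolding partition_word_def by (rule arg_cong)
  then show ?thesis by (simp add: partition_word_def[of "\<mu> @ [a]"])
qed

lemma length_partition_word: "length (partition_word \<mu>) = sum_list \<mu>"
  by (induction \<mu> rule: rev_induct) (auto simp: partition_word_snoc)

lemma set_partition_word: "0 \<notin> set \<mu> \<Longrightarrow> set (partition_word \<mu>) = {1..length \<mu>}"
  by (induction \<mu> rule: rev_induct) (auto simp: partition_word_snoc)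

lemma count_partition_word:
  "i < length \<mu> \<Longrightarrow> count_list (partition_word \<mu>) (Suc i) = \<mu> ! i"
proof (induction \<mu> rule: rev_induct)
  case (snoc a \<mu>)
  have le: "k \<le> length \<mu>" if "k \<in> set (partition_word \<mu>)" for k
    using that by (auto simp: partition_word_def)
  have rep: "count_list (replicate m x) y = (if x = y then m else 0)" for m and x y :: nat
    by (induction m) auto
  have "count_list (partition_word \<mu>) (Suc (length \<mu>)) = 0"
    using le by (fastforce simp: count_list_0_iff)
  then show ?case
    using snoc by (cases "i = length \<mu>") (auto simp: partition_word_snoc nth_append rep)
qed simp

lemma rg_word_partition_word: "0 \<notin> set \<mu> \<Longrightarrow> rg_word (partition_word \<mu>)"
proof (induction \<mu> rule: rev_induct)
  case (snoc a \<mu>)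
  let ?k = "Suc (length \<mu>)"
  have w: "rg_word (partition_word \<mu>)" "set (partition_word \<mu>) = {1..length \<mu>}"
    using snoc set_partition_word by auto
  have max: "Max (insert 0 {1..length \<mu>}) = length \<mu>"
    by (intro Max_eqI) (auto simp: Suc_le_eq)
  have "rg_word (partition_word \<mu> @ replicate m ?k)" for m
  proof (induction m)
    case (Suc m)
    have "Max (insert 0 {1..length \<mu>}) \<le> Max (insert 0 (set (partition_word \<mu> @ replicate m ?k)))"
      using w by (intro Max_mono) auto
    then have "rg_word ((partition_word \<mu> @ replicate m ?k) @ [?k])"
      unfolding rg_word_snoc using Suc max by auto
    then show ?case by (simp add: replicate_append_same)
  qed (use w in simp)
  then show ?case by (simp add: partition_word_snoc)
qed simp

lemma convex_word_Nil [simp]: "convex_word []"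
  by (auto simp: convex_word_def is_partition_def intro!: exI[of _ "[]"])

lemma rg_word_convex: "convex_word w \<Longrightarrow> rg_word w"
  by (auto simp: convex_word_def is_partition_def intro: rg_word_partition_word)

lemma convex_word_prefix:
  assumes "convex_word (u @ v)"
  shows "convex_word u"
proof -
  have "convex_word u" if "is_partition \<mu>" "u @ v = partition_word \<mu>" for \<mu>
    using that
  proof (induction \<mu> arbitrary: u v rule: rev_induct)
    case (snoc a \<mu>)
    have \<mu>: "is_partition \<mu>" using snoc.prems(1) by (auto simp: is_partition_def sorted_wrt_append)
    from snoc.prems(2) consider x where "partition_word \<mu> = u @ x"
      | x where "u = partition_word \<mu> @ x" "x @ v = replicate a (Suc (length \<mu>))"
      unfolding partition_word_snoc append_eq_append_conv2 by metis
    then show ?case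
    proof cases
      case 1
      then show ?thesis using snoc.IH[OF \<mu>] by metis
    next
      case 2
      define c where "c = length x"
      have x: "x = replicate c (Suc (length \<mu>))" "c \<le> a"
        using arg_cong[OF 2(2), of "take c"] arg_cong[OF 2(2), of length] by (auto simp: c_def)
      show ?thesis
      proof (cases "c = 0")
        case True
        then show ?thesis using \<mu> x 2 by (auto simp: convex_word_def)
      next
        case False
        then have "is_partition (\<mu> @ [c])"
          using snoc.prems(1) x(2) by (force simp: is_partition_def sorted_wrt_append)
        moreover have "u = partition_word (\<mu> @ [c])" using x 2 by (simp add: partition_word_snoc)
        ultimately show ?thesis unfolding convex_word_def by blast
      qed
    qed
  qed simp
  then show ?thesis using assms by (auto simp: convex_word_def)
qed

lemma bimodal_scan_bimodal:
  assumes "convex_word (acc @ concat ps)" "\<not> convex_word (acc @ concat ps @ p)"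
  shows "bimodal_scan acc (ps @ p # rest) =
    (let (fs, t) = bimodal_scan [] rest in ((acc @ concat ps @ p) # fs, t))"
  using assms
proof (induction ps arbitrary: acc)
  case (Cons q ps)
  then have "convex_word (acc @ q)" using convex_word_prefix[of "acc @ q" "concat ps"] by simp
  then show ?case using Cons.IH[of "acc @ q"] Cons.prems by simp
qed simp

lemma bimodal_scan_convex:
  "convex_word (acc @ concat ps) \<Longrightarrow> bimodal_scan acc ps = ([], acc @ concat ps)"
proof (induction ps arbitrary: acc)
  case (Cons q ps)
  then have "convex_word (acc @ q)" using convex_word_prefix[of "acc @ q" "concat ps"] by simp
  then show ?case using Cons.IH[of "acc @ q"] Cons.prems by simp
qed simp

lemma bimodal_decomposition_unique:
  assumes "\<forall>v\<in>set vs. bimodal_word v" "convex_word t"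
  shows "bimodal_factors (concat vs @ t) = vs" "bimodal_tail (concat vs @ t) = t"
proof -
  have "\<exists>ps. (\<forall>p\<in>set ps. primary p) \<and> concat ps = concat vs @ t \<and> bimodal_scan [] ps = (vs, t)"
    using assms(1)
  proof (induction vs)
    case Nil
    have "rg_word t" using assms(2) by (rule rg_word_convex)
    then show ?case
      using assms(2) maximal_splitting[of t] bimodal_scan_convex[of "[]" "maximal_splitting t"]
      by (intro exI[of _ "maximal_splitting t"]) simp
  next
    case (Cons v vs)
    then obtain ps where ps: "\<forall>p\<in>set ps. primary p" "concat ps = concat vs @ t"
      "bimodal_scan [] ps = (vs, t)" by auto
    obtain qs q where q: "\<forall>q\<in>set (qs @ [q]). primary q" "v = concat (qs @ [q])"
      "convex_word (concat qs)" "\<not> convex_word v"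
      using Cons.prems by (auto simp: bimodal_word_def)
    have "bimodal_scan [] (qs @ q # ps) = (v # vs, t)"
      using bimodal_scan_bimodal[of "[]" qs q ps] q ps(3) by simp
    then show ?case using ps q by (intro exI[of _ "qs @ q # ps"]) auto
  qed
  then obtain ps where ps: "\<forall>p\<in>set ps. primary p" "concat ps = concat vs @ t"
    "bimodal_scan [] ps = (vs, t)" by blast
  then have "maximal_splitting (concat vs @ t) = ps" using maximal_splitting_concat by metis
  then show "bimodal_factors (concat vs @ t) = vs" "bimodal_tail (concat vs @ t) = t"
    using ps(3) by (auto simp: bimodal_factors_def bimodal_tail_def)
qed

lemma bimodal_scan_correct:
  assumes "convex_word (concat qs)" "\<forall>p\<in>set (qs @ ps). primary p"
    and "bimodal_scan (concat qs) ps = (fs, t)"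
  shows "(\<forall>f\<in>set fs. bimodal_word f) \<and> convex_word t \<and> concat fs @ t = concat qs @ concat ps"
  using assms
proof (induction ps arbitrary: qs fs)
  case (Cons p ps)
  show ?case
  proof (cases "convex_word (concat qs @ p)")
    case True
    then show ?thesis using Cons.IH[of "qs @ [p]" fs] Cons.prems by simp
  next
    case False
    obtain fs' where fs: "bimodal_scan [] ps = (fs', t)" "fs = (concat qs @ p) # fs'"
      using Cons.prems(3) False by (auto split: prod.splits)
    have "rg_word (concat (qs @ [p]))"
      using Cons.prems(2) by (intro rg_word_concat) (auto simp: primary_def)
    then have "bimodal_word (concat qs @ p)"
      using False Cons.prems unfolding bimodal_word_def
      by (intro conjI exI[of _ qs] exI[of _ p]) auto
    then show ?thesis using Cons.IH[of "[]" fs'] Cons.prems fs by simp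
  qed
qed simp

lemma bimodal_decomposition:
  assumes "rg_word w"
  shows "\<forall>f\<in>set (bimodal_factors w). bimodal_word f" "convex_word (bimodal_tail w)"
    "concat (bimodal_factors w) @ bimodal_tail w = w"
  using bimodal_scan_correct[of "[]" "maximal_splitting w" "bimodal_factors w" "bimodal_tail w"]
    maximal_splitting[OF assms]
  by (auto simp: bimodal_factors_def bimodal_tail_def)

lemma tail_free_wordsD:
  assumes "w \<in> tail_free_words n"
  shows "rg_word w" "set w \<subseteq> {1..n}" "\<forall>f\<in>set (bimodal_factors w). bimodal_word f"
    "concat (bimodal_factors w) = w"
  using assms bimodal_decomposition[of w] by (auto simp: tail_free_words_def)

lemma tail_free_wordsI:
  assumes "\<forall>v\<in>set vs. bimodal_word v" "set (concat vs) \<subseteq> {1..n}"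
  shows "concat vs \<in> tail_free_words n" "bimodal_factors (concat vs) = vs"
proof -
  have "rg_word (concat vs)" using assms(1) by (intro rg_word_concat) (auto simp: bimodal_word_def)
  then show "concat vs \<in> tail_free_words n" "bimodal_factors (concat vs) = vs"
    using bimodal_decomposition_unique[OF assms(1), of "[]"] assms(2)
    by (auto simp: tail_free_words_def)
qed

section \<open>Types of words\<close>

lemma monomial_type_eq_image:
  "monomial_type z = (\<lambda>x. {i \<in> {1..length z}. z ! (i - 1) = x}) ` set z"
  by (auto simp: monomial_type_def)

lemma Union_monomial_type: "\<Union>(monomial_type z) = {1..length z}"
proof
  show "{1..length z} \<subseteq> \<Union>(monomial_type z)"
  proof
    fix i assume i: "i \<in> {1..length z}"
    then have "z ! (i - 1) \<in> set z" by (intro nth_mem) auto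
    then show "i \<in> \<Union>(monomial_type z)" using i by (auto simp: monomial_type_def)
  qed
qed (auto simp: monomial_type_def)

lemma monomial_type_eqD:
  assumes "monomial_type z = monomial_type v"
  shows "length z = length v"
    and "i < length v \<Longrightarrow> j < length v \<Longrightarrow> z ! i = z ! j \<longleftrightarrow> v ! i = v ! j"
proof -
  show len: "length z = length v"
    using arg_cong[OF assms, of "\<lambda>A. card (\<Union>A)"] by (simp add: Union_monomial_type)
  have "(\<exists>B\<in>monomial_type y. Suc i \<in> B \<and> Suc j \<in> B) \<longleftrightarrow> y ! i = y ! j"
    if "i < length y" "j < length y" for y :: "nat list" and i j
  proof
    assume "y ! i = y ! j"
    then show "\<exists>B\<in>monomial_type y. Suc i \<in> B \<and> Suc j \<in> B"
      using that unfolding monomial_type_eq_image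
      by (intro bexI[of _ "{k \<in> {1..length y}. y ! (k - 1) = y ! i}"]) auto
  qed (auto simp: monomial_type_def)
  then show "z ! i = z ! j \<longleftrightarrow> v ! i = v ! j" if "i < length v" "j < length v"
    using that assms len by metis
qed

lemma monomial_type_map:
  assumes "inj_on f (set z)"
  shows "monomial_type (map f z) = monomial_type z"
proof -
  have "{i \<in> {1..length z}. map f z ! (i - 1) = f x} = {i \<in> {1..length z}. z ! (i - 1) = x}"
    if "x \<in> set z" for x
    using that assms by (auto simp: inj_on_eq_iff)
  then show ?thesis by (simp add: monomial_type_eq_image image_image)
qed

lemma monomial_type_rg_inj:
  "rg_word v \<Longrightarrow> rg_word w \<Longrightarrow> monomial_type v = monomial_type w \<Longrightarrow> v = w"
  by (metis growth_word_inverse(2))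

lemma rg_word_of_type:
  "\<exists>w. rg_word w \<and> set w = {1..card (set z)} \<and> monomial_type w = monomial_type z"
proof -
  have "\<exists>f. inj_on f (set z) \<and> f ` set z = {1..card (set z)} \<and> rg_word (map f z)"
  proof (induction z rule: rev_induct)
    case (snoc x z)
    then obtain f where f: "inj_on f (set z)" "f ` set z = {1..card (set z)}" "rg_word (map f z)"
      by blast
    let ?k = "card (set z)"
    have max: "Max (insert 0 {1..?k}) = ?k" by (intro Max_eqI) (auto simp: Suc_le_eq card_gt_0_iff)
    show ?case
    proof (cases "x \<in> set z")
      case True
      then have "f x \<in> {1..?k}" using f(2) by blast
      then have "rg_word (map f z @ [f x])"
        unfolding rg_word_snoc set_map f(2) max using f(3) by auto
      then show ?thesis using f True by (intro exI[of _ f]) (auto simp: insert_absorb)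
    next
      case False
      define g where "g = f(x := Suc ?k)"
      have g: "map g z = map f z" "g ` set z = f ` set z" "inj_on g (set z)" "g x = Suc ?k"
        using False f(1) by (auto simp: g_def inj_on_def)
      have "rg_word (map g (z @ [x]))"
        using f(3) max by (simp add: g rg_word_snoc f(2))
      moreover have "g x \<notin> g ` set z" by (simp add: g(2,4) f(2))
      then have "inj_on g (set (z @ [x]))" using g(3) False by simp
      moreover have "g ` set (z @ [x]) = {1..card (set (z @ [x]))}"
        using False g f(2) by auto
      ultimately show ?thesis by blast
    qed
  qed simp
  then show ?thesis using monomial_type_map by (metis set_map)
qed

lemma rg_word_lex_least:
  assumes v: "rg_word v" and type: "monomial_type z = monomial_type v" and pos: "0 \<notin> set z"
  shows "z = v \<or> (v, z) \<in> lex less_than"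
proof (rule disjCI)
  assume nl: "(v, z) \<notin> lex less_than"
  note len = monomial_type_eqD(1)[OF type]
  have "z ! i = v ! i" if "i < length v" for i
    using that
  proof (induction i rule: less_induct)
    case (less i)
    then have prev: "z ! j = v ! j" if "j < i" for j using that by auto
    have take: "take i z = take i v" using prev len less.prems by (intro nth_take_lemma) auto
    show ?case
    proof (cases "\<exists>j<i. v ! j = v ! i")
      case True
      then show ?thesis using prev monomial_type_eqD(2)[OF type] less.prems by (metis less_trans)
    next
      case False
      have "\<not> z ! i < v ! i"
      proof
        assume "z ! i < v ! i"
        moreover have "z ! i \<in> set z" using len less.prems by simp
        then have "1 \<le> z ! i" using pos by (metis One_nat_def Suc_leI not_gr_zero)
        ultimately obtain j where j: "j \<le> i" "v ! j = z ! i"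
          using rg_word_first_occurrence[OF v less.prems, of "z ! i"] by auto
        then have "j \<noteq> i" using \<open>z ! i < v ! i\<close> by auto
        then have "z ! j = z ! i" using j prev by auto
        then have "v ! j = v ! i" using monomial_type_eqD(2)[OF type] less.prems j by auto
        then show False using j \<open>z ! i < v ! i\<close> by simp
      qed
      moreover have "\<not> v ! i < z ! i"
      proof
        assume "v ! i < z ! i"
        then have "(v, z) \<in> lex less_than"
          using len less.prems take id_take_nth_drop[of i v] id_take_nth_drop[of i z]
          unfolding lex_conv by (metis (mono_tags, lifting) case_prodI less_than_iff mem_Collect_eq)
        then show False using nl by blast
      qed
      ultimately show ?thesis by simp
    qed
  qed
  then show "z = v" using len by (intro nth_equalityI) auto
qed

section \<open>Monomial functions\<close>

definition word_sum :: "nat list set \<Rightarrow> 'k::field_char_0 ncpoly" where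
  "word_sum Z = (\<Sum>z\<in>Z. Poly_Mapping.single (Mon z) 1)"

lemma lookup_word_sum:
  "finite Z \<Longrightarrow> Poly_Mapping.lookup (word_sum Z) (Mon z) = of_bool (z \<in> Z)"
  by (simp add: word_sum_def lookup_sum lookup_single when_def of_bool_def)

lemma word_sum_mult:
  assumes "\<And>y. y \<in> Y \<Longrightarrow> length y = d"
  shows "word_sum Y * word_sum Z = (word_sum ((\<lambda>(y, z). y @ z) ` (Y \<times> Z)) :: 'k::field_char_0 ncpoly)"
proof -
  have "inj_on (\<lambda>(y, z). y @ z) (Y \<times> Z)"
    using assms by (auto simp: inj_on_def)
  then have "(word_sum ((\<lambda>(y, z). y @ z) ` (Y \<times> Z)) :: 'k ncpoly) =
      (\<Sum>(y, z)\<in>Y \<times> Z. Poly_Mapping.single (Mon (y @ z)) 1)"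
    by (simp only: word_sum_def sum.reindex) (simp add: case_prod_beta)
  then show ?thesis
    by (simp add: word_sum_def[of Y] word_sum_def[of Z] sum_product sum.cartesian_product
        mult_single plus_monomial_def)
qed

definition words_of_type :: "nat \<Rightarrow> nat set set \<Rightarrow> nat list set" where
  "words_of_type n A = {z. set z \<subseteq> {1..n} \<and> monomial_type z = A}"

lemma length_words_of_type: "z \<in> words_of_type n A \<Longrightarrow> length z = card (\<Union>A)"
  using Union_monomial_type[of z] by (auto simp: words_of_type_def)

lemma finite_words_of_type: "finite (words_of_type n A)"
proof (rule finite_subset)
  show "words_of_type n A \<subseteq> {z. set z \<subseteq> {1..n} \<and> length z = card (\<Union>A)}"
    using length_words_of_type[of _ n A] by (auto simp: words_of_type_def)
qed (simp add: finite_lists_length_eq)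

lemma m_set_eq_word_sum: "m_set n A = word_sum (words_of_type n A)"
  by (simp add: m_set_def word_sum_def words_of_type_def)

lemma lookup_m_set:
  "Poly_Mapping.lookup (m_set n A) (Mon z) = of_bool (set z \<subseteq> {1..n} \<and> monomial_type z = A)"
  by (simp add: m_set_eq_word_sum lookup_word_sum finite_words_of_type) (simp add: words_of_type_def)

lemma m_word_eq_0:
  assumes "rg_word w" "\<not> set w \<subseteq> {1..n}"
  shows "m_word n w = 0"
proof -
  have "z \<notin> words_of_type n (monomial_type w)" for z
  proof
    assume z: "z \<in> words_of_type n (monomial_type w)"
    obtain w' where w': "rg_word w'" "set w' = {1..card (set z)}" "monomial_type w' = monomial_type z"
      using rg_word_of_type by blast
    have "w' = w" using w' z assms(1) by (intro monomial_type_rg_inj) (auto simp: words_of_type_def)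
    moreover have "card (set z) \<le> n"
      using z card_mono[of "{1..n}" "set z"] by (simp add: words_of_type_def)
    ultimately show False using w'(2) assms(2) by auto
  qed
  then have "words_of_type n (monomial_type w) = {}" by blast
  then show ?thesis by (simp add: m_word_eq[OF assms(1)] m_set_eq_word_sum word_sum_def)
qed

lemma basis_family_NCSym:
  "basis_family {w. rg_word w \<and> set w \<subseteq> {1..n}} (m_word n) (NCSym n :: 'k::field_char_0 ncpoly set)"
proof -
  let ?W = "{w. rg_word w \<and> set w \<subseteq> {1..n}}"
  have "basis_family ?W (m_word n :: _ \<Rightarrow> 'k ncpoly) (pm.span (m_word n ` ?W))"
  proof (rule triangular_basis_family[of "{}" _ _ Mon])
    fix v w
    assume "v \<in> ?W" "w \<in> ?W" "Poly_Mapping.lookup (m_word n w :: 'k ncpoly) (Mon v) \<noteq> 0" "v \<noteq> w"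
    then show "(w, v) \<in> {}"
      using monomial_type_rg_inj[of v w] by (auto simp: m_word_eq lookup_m_set)
  qed (auto simp: m_word_eq lookup_m_set)
  moreover have "pm.span (m_word n ` ?W) = (NCSym n :: 'k ncpoly set)"
  proof (rule antisym)
    show "pm.span (m_word n ` ?W) \<subseteq> (NCSym n :: 'k ncpoly set)"
      unfolding NCSym_def
      using growth_word_inverse(1) by (intro pm.span_mono) (fastforce simp: m_word_eq)
    have "(m_set n A :: 'k ncpoly) \<in> pm.span (m_word n ` ?W)" if A: "partition_on {1..d} A" for A d
    proof -
      obtain w where w: "rg_word w" "monomial_type w = A"
        using rg_word_of_type monomial_type_growth_word[OF A] by metis
      show ?thesis
      proof (cases "set w \<subseteq> {1..n}")
        case True
        then show ?thesis using w by (intro pm.span_base image_eqI[of _ _ w]) (auto simp: m_word_eq)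
      next
        case False
        then show ?thesis using w m_word_eq[OF w(1), of n] m_word_eq_0[OF w(1) False]
          by (metis pm.span_zero)
      qed
    qed
    then show "(NCSym n :: 'k ncpoly set) \<subseteq> pm.span (m_word n ` ?W)"
      unfolding NCSym_def by (intro pm.span_minimal) auto
  qed
  ultimately show ?thesis by simp
qed

section \<open>The algebra generated by the bimodal words\<close>

lemma prod_m_word_eq_word_sum:
  assumes "\<forall>v\<in>set vs. rg_word v"
  shows "prod_list (map (m_word n) vs) =
    (word_sum {concat zs | zs. list_all2 (\<lambda>z v. z \<in> words_of_type n (monomial_type v)) zs vs}
      :: 'k::field_char_0 ncpoly)"
  using assms
proof (induction vs)
  case Nil
  show ?case using single_one[where 'a = monomial and 'b = 'k] by (simp add: word_sum_def zero_monomial_def)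
next
  case (Cons v vs)
  let ?Z = "\<lambda>vs. {concat zs | zs. list_all2 (\<lambda>z v. z \<in> words_of_type n (monomial_type v)) zs vs}"
  have "?Z (v # vs) = (\<lambda>(y, z). y @ z) ` (words_of_type n (monomial_type v) \<times> ?Z vs)"
  proof (intro equalityI subsetI)
    fix u assume "u \<in> ?Z (v # vs)"
    then show "u \<in> (\<lambda>(y, z). y @ z) ` (words_of_type n (monomial_type v) \<times> ?Z vs)"
      by (force simp: list_all2_Cons2)
  next
    fix u assume "u \<in> (\<lambda>(y, z). y @ z) ` (words_of_type n (monomial_type v) \<times> ?Z vs)"
    then obtain y zs where "y \<in> words_of_type n (monomial_type v)" "u = concat (y # zs)"
      "list_all2 (\<lambda>z v. z \<in> words_of_type n (monomial_type v)) zs vs" by auto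
    then show "u \<in> ?Z (v # vs)" by (metis (mono_tags, lifting) list.rel_intros(2) mem_Collect_eq)
  qed
  then show ?case
    using Cons length_words_of_type
    by (simp add: m_word_eq m_set_eq_word_sum word_sum_mult[of _ "card (\<Union>(monomial_type v))"])
qed

lemma lookup_bimodal_product:
  assumes "w \<in> tail_free_words n"
  shows "Poly_Mapping.lookup (bimodal_product n w :: 'k::field_char_0 ncpoly) (Mon w) = 1"
    and "Poly_Mapping.lookup (bimodal_product n w :: 'k ncpoly) (Mon u) \<noteq> 0 \<Longrightarrow>
      u \<noteq> w \<Longrightarrow> (w, u) \<in> lex less_than"
proof -
  define vs where "vs = bimodal_factors w"
  define Z where "Z = {concat zs | zs. list_all2 (\<lambda>z v. z \<in> words_of_type n (monomial_type v)) zs vs}"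
  note w = tail_free_wordsD[OF assms, folded vs_def]
  have rg: "\<forall>v\<in>set vs. rg_word v" using w(3) by (simp add: bimodal_word_def)
  have prod: "bimodal_product n w = (word_sum Z :: 'k ncpoly)"
    unfolding bimodal_product_def Z_def vs_def[symmetric] by (rule prod_m_word_eq_word_sum[OF rg])
  have least: "length (concat zs) = length (concat vs) \<and> set (concat zs) \<subseteq> {1..n} \<and>
      (concat zs = concat vs \<or> (concat vs, concat zs) \<in> lex less_than)"
    if "list_all2 (\<lambda>z v. z \<in> words_of_type n (monomial_type v)) zs vs" for zs
    using that rg
  proof (induction rule: list_all2_induct)
    case (Cons z zs v vs)
    have z: "set z \<subseteq> {1..n}" "monomial_type z = monomial_type v"
      using Cons.hyps by (auto simp: words_of_type_def)
    have "z = v \<or> (v, z) \<in> lex less_than"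
      using Cons.prems z by (intro rg_word_lex_least) auto
    then show ?case
      using Cons.IH Cons.prems z monomial_type_eqD(1)[OF z(2)]
      by (auto intro: lex_append_leftI lex_append_rightI)
  qed simp
  have "finite Z"
  proof (rule finite_subset)
    show "Z \<subseteq> {z. set z \<subseteq> {1..n} \<and> length z = length (concat vs)}"
      using least unfolding Z_def by blast
  qed (simp add: finite_lists_length_eq)
  then have lookup: "Poly_Mapping.lookup (bimodal_product n w :: 'k ncpoly) (Mon z) = of_bool (z \<in> Z)" for z
    unfolding prod by (rule lookup_word_sum)
  have "set v \<subseteq> {1..n}" if "v \<in> set vs" for v using that w(2) unfolding w(4)[symmetric] by auto
  then have "list_all2 (\<lambda>z v. z \<in> words_of_type n (monomial_type v)) vs vs"
    by (auto simp: list_all2_same words_of_type_def)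
  then have "w \<in> Z" using w(4) unfolding Z_def by blast
  then show "Poly_Mapping.lookup (bimodal_product n w :: 'k ncpoly) (Mon w) = 1"
    by (simp add: lookup)
  assume "Poly_Mapping.lookup (bimodal_product n w :: 'k ncpoly) (Mon u) \<noteq> 0" "u \<noteq> w"
  then have "u \<in> Z" by (simp add: lookup)
  then show "(w, u) \<in> lex less_than" using least w(4) \<open>u \<noteq> w\<close> by (auto simp: Z_def)
qed

lemma subalgebra_hull: "subalgebra (subalgebra hull S)"
  unfolding hull_def subalgebra_def by (auto intro!: pm.subspace_Inter)

lemma subalgebra_prod_list: "subalgebra A \<Longrightarrow> set fs \<subseteq> A \<Longrightarrow> prod_list fs \<in> A"
  by (induction fs) (auto simp: subalgebra_def)

lemma pm_scale_mult:
  fixes f g :: "'k::field ncpoly"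
  shows "pm_scale c f * g = pm_scale c (f * g)" "f * pm_scale c g = pm_scale c (f * g)"
proof -
  have single: "pm_scale c (Poly_Mapping.single a d) = Poly_Mapping.single a (c * d)"
    for c d and a :: monomial
    by (rule poly_mapping_eqI) (simp add: lookup_single when_def)
  have "pm_scale c h = Poly_Mapping.single 0 c * h \<and> pm_scale c h = h * Poly_Mapping.single 0 c"
    for h :: "'k ncpoly"
  proof -
    have h: "h = (\<Sum>a\<in>Poly_Mapping.keys h. Poly_Mapping.single a (Poly_Mapping.lookup h a))"
      using pm_expand[of h] by (simp add: single)
    have "pm_scale c h = (\<Sum>a\<in>Poly_Mapping.keys h. Poly_Mapping.single a (c * Poly_Mapping.lookup h a))"
      by (subst h) (simp add: pm.scale_sum_right single)
    moreover have "Poly_Mapping.single 0 c * h =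
        (\<Sum>a\<in>Poly_Mapping.keys h. Poly_Mapping.single a (c * Poly_Mapping.lookup h a))"
      by (subst h) (simp add: sum_distrib_left mult_single)
    moreover have "h * Poly_Mapping.single 0 c =
        (\<Sum>a\<in>Poly_Mapping.keys h. Poly_Mapping.single a (c * Poly_Mapping.lookup h a))"
      by (subst h) (simp add: sum_distrib_right mult_single mult.commute)
    ultimately show ?thesis by simp
  qed
  then show "pm_scale c f * g = pm_scale c (f * g)" "f * pm_scale c g = pm_scale c (f * g)"
    by (metis mult.assoc)+
qed

lemma C_algebra_eq_span:
  "C_algebra n = pm.span (bimodal_product n ` tail_free_words n :: 'k::field_char_0 ncpoly set)"
  (is "_ = pm.span ?P")
proof (rule antisym)
  have mult: "f * g \<in> pm.span ?P" if fg: "f \<in> ?P" "g \<in> ?P" for f g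
  proof -
    obtain v w where vw: "v \<in> tail_free_words n" "w \<in> tail_free_words n"
      "f = bimodal_product n v" "g = bimodal_product n w" using fg by blast
    define us where "us = bimodal_factors v @ bimodal_factors w"
    have us: "\<forall>u\<in>set us. bimodal_word u" "set (concat us) \<subseteq> {1..n}"
      using tail_free_wordsD[OF vw(1)] tail_free_wordsD[OF vw(2)] by (auto simp: us_def)
    have "f * g = bimodal_product n (concat us)"
      unfolding vw bimodal_product_def tail_free_wordsI(2)[OF us] by (simp add: us_def)
    then show ?thesis using tail_free_wordsI(1)[OF us] by (auto intro: pm.span_base)
  qed
  have left: "f * g \<in> pm.span ?P" if "f \<in> ?P" "g \<in> pm.span ?P" for f g
    using that(2)
  proof (induction rule: pm.span_induct_alt)
    case (step c x y)
    then show ?case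
      using mult[OF that(1) step(1)] by (simp add: distrib_left pm_scale_mult pm.span_add pm.span_scale)
  qed (simp add: pm.span_zero)
  have "f * g \<in> pm.span ?P" if "f \<in> pm.span ?P" "g \<in> pm.span ?P" for f g
    using that(1)
  proof (induction rule: pm.span_induct_alt)
    case (step c x y)
    then show ?case
      using left[OF step(1) that(2)] by (simp add: distrib_right pm_scale_mult pm.span_add pm.span_scale)
  qed (simp add: pm.span_zero)
  moreover have "1 \<in> pm.span ?P"
  proof -
    have "[] \<in> tail_free_words n" "bimodal_factors [] = []" using tail_free_wordsI[of "[]" n] by auto
    then have "1 \<in> ?P" by (intro image_eqI[of _ _ "[]"]) (auto simp: bimodal_product_def)
    then show ?thesis by (rule pm.span_base)
  qed
  ultimately have "subalgebra (pm.span ?P)" by (simp add: subalgebra_def)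
  moreover have "m_word n v \<in> pm.span ?P" if v: "bimodal_word v" for v
  proof (cases "set v \<subseteq> {1..n}")
    case True
    then have "v \<in> tail_free_words n" "bimodal_factors v = [v]"
      using tail_free_wordsI[of "[v]" n] v by auto
    then show ?thesis
      by (intro pm.span_base image_eqI[of _ _ v]) (auto simp: bimodal_product_def)
  next
    case False
    then show ?thesis using v by (simp add: m_word_eq_0 bimodal_word_def pm.span_zero)
  qed
  ultimately show "C_algebra n \<subseteq> pm.span ?P"
    unfolding C_algebra_def by (intro hull_minimal) auto
  have "bimodal_product n w \<in> (C_algebra n :: 'k ncpoly set)" if "w \<in> tail_free_words n" for w
    unfolding bimodal_product_def C_algebra_def using tail_free_wordsD(3)[OF that]
    by (intro subalgebra_prod_list subalgebra_hull) (auto intro: hull_inc)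
  moreover have "pm.subspace (C_algebra n :: 'k ncpoly set)"
    using subalgebra_hull by (auto simp: C_algebra_def subalgebra_def)
  ultimately show "pm.span ?P \<subseteq> C_algebra n" by (intro pm.span_minimal) auto
qed

lemma basis_family_C_algebra:
  "basis_family (tail_free_words n) (bimodal_product n) (C_algebra n :: 'k::field_char_0 ncpoly set)"
  unfolding C_algebra_eq_span
proof (rule triangular_basis_family[of "lex less_than" _ _ Mon])
  show "wf (lex less_than)" by (intro wf_lex wf_less_than)
qed (use lookup_bimodal_product in \<open>auto simp: lookup_bimodal_product\<close>)

section \<open>The commutative part\<close>

lemma shape_monomial_type:
  "shape (monomial_type z) = rev (sorted_list_of_multiset (image_mset (count_list z) (mset_set (set z))))"
proof -
  define S where "S x = {i \<in> {1..length z}. z ! (i - 1) = x}" for x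
  have card: "card (S x) = count_list z x" for x
  proof -
    have "S x = Suc ` {i. i < length z \<and> x = z ! i}"
    proof (intro equalityI subsetI)
      fix i assume "i \<in> S x"
      then show "i \<in> Suc ` {i. i < length z \<and> x = z ! i}"
        by (intro image_eqI[of _ _ "i - 1"]) (auto simp: S_def)
    qed (auto simp: S_def)
    then have "card (S x) = card {i. i < length z \<and> x = z ! i}" by (simp add: card_image)
    then show ?thesis by (simp add: count_list_eq_length_filter length_filter_conv_card)
  qed
  have "inj_on S (set z)"
  proof (rule inj_onI)
    fix x y assume "x \<in> set z" "y \<in> set z" "S x = S y"
    then have "card (S x) \<noteq> 0" by (simp add: card count_list_0_iff)
    then obtain i where "i \<in> S x" by fastforce
    then have "i \<in> S x" "i \<in> S y" using \<open>S x = S y\<close> by blast+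
    then show "x = y" by (simp add: S_def)
  qed
  then have "mset_set (monomial_type z) = image_mset S (mset_set (set z))"
    by (simp add: image_mset_mset_set monomial_type_eq_image S_def)
  then show ?thesis by (simp add: shape_def image_mset.compositionality comp_def card)
qed

lemma shape_partition_word:
  assumes "is_partition \<mu>"
  shows "shape (monomial_type (partition_word \<mu>)) = \<mu>"
proof -
  have "{1..length \<mu>} = Suc ` {0..<length \<mu>}" by auto
  then have "mset_set {1..length \<mu>} = image_mset Suc (mset_set {0..<length \<mu>})"
    by (simp add: image_mset_mset_set)
  then have "image_mset (count_list (partition_word \<mu>)) (mset_set {1..length \<mu>}) =
      image_mset (\<lambda>i. count_list (partition_word \<mu>) (Suc i)) (mset_set {0..<length \<mu>})"
    by (simp add: image_mset.compositionality comp_def)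
  also have "\<dots> = image_mset (\<lambda>i. \<mu> ! i) (mset_set {0..<length \<mu>})"
    by (intro image_mset_cong) (simp add: count_partition_word)
  also have "\<dots> = mset (map (\<lambda>i. \<mu> ! i) [0..<length \<mu>])" by simp
  also have "\<dots> = mset \<mu>" by (simp only: map_nth)
  finally have "shape (monomial_type (partition_word \<mu>)) = rev (sort \<mu>)"
    using assms by (simp add: shape_monomial_type set_partition_word is_partition_def)
  moreover have "sort \<mu> = rev \<mu>"
    using assms by (intro properties_for_sort) (auto simp: is_partition_def sorted_wrt_rev)
  ultimately show ?thesis by simp
qed

lemma finite_set_partitions_of_shape: "finite (set_partitions_of_shape \<mu>)"
proof (rule finite_subset)
  show "set_partitions_of_shape \<mu> \<subseteq> Pow (Pow {1..sum_list \<mu>})"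
    by (auto simp: set_partitions_of_shape_def partition_on_def)
qed simp

lemma partition_word_mem_shape:
  assumes "is_partition \<mu>"
  shows "monomial_type (partition_word \<mu>) \<in> set_partitions_of_shape \<mu>"
  using assms growth_word_inverse(1)[OF rg_word_partition_word, of \<mu>] shape_partition_word[OF assms]
  by (simp add: set_partitions_of_shape_def length_partition_word is_partition_def)

lemma lookup_m_part:
  assumes "\<mu> \<in> partitions_upto n" "\<nu> \<in> partitions_upto n"
  shows "Poly_Mapping.lookup (m_part n \<nu> :: 'k::field_char_0 ncpoly) (Mon (partition_word \<mu>)) \<noteq> 0
    \<longleftrightarrow> \<mu> = \<nu>"
proof -
  have part: "is_partition \<mu>" "set (partition_word \<mu>) \<subseteq> {1..n}" "is_partition \<nu>"
      "set (partition_word \<nu>) \<subseteq> {1..n}"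
    using assms set_partition_word[of \<mu>] set_partition_word[of \<nu>]
    by (auto simp: partitions_upto_def is_partition_def)
  let ?M = "m_set n ` set_partitions_of_shape \<nu> :: 'k ncpoly set"
  have dim: "pm.dim (NCSym_shape n \<nu> :: 'k ncpoly set) \<noteq> 0"
  proof
    assume "pm.dim (NCSym_shape n \<nu> :: 'k ncpoly set) = 0"
    then have "pm.dim ?M = 0" by (simp add: NCSym_shape_def)
    obtain B where B: "B \<subseteq> ?M" "?M \<subseteq> pm.span B" "card B = pm.dim ?M"
      using pm.basis_exists by blast
    then have "finite B" using finite_set_partitions_of_shape by (meson finite_imageI finite_subset)
    then have "B = {}" using B(3) \<open>pm.dim ?M = 0\<close> by simp
    then have "(m_set n (monomial_type (partition_word \<nu>)) :: 'k ncpoly) = 0"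
      using B(2) partition_word_mem_shape[OF part(3)] by auto
    then have "Poly_Mapping.lookup (m_set n (monomial_type (partition_word \<nu>)) :: 'k ncpoly)
        (Mon (partition_word \<nu>)) = 0" by simp
    then show False using part(4) by (simp add: lookup_m_set)
  qed
  have "Poly_Mapping.lookup (\<Sum>A\<in>set_partitions_of_shape \<nu>. m_set n A :: 'k ncpoly)
      (Mon (partition_word \<mu>)) = of_bool (monomial_type (partition_word \<mu>) \<in> set_partitions_of_shape \<nu>)"
    using part(2) finite_set_partitions_of_shape[of \<nu>]
    by (simp add: lookup_sum lookup_m_set of_bool_def)
  moreover have "monomial_type (partition_word \<mu>) \<in> set_partitions_of_shape \<nu> \<longleftrightarrow> \<mu> = \<nu>"
    using partition_word_mem_shape[OF part(1)] shape_partition_word[OF part(1)]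
    by (auto simp: set_partitions_of_shape_def)
  ultimately show ?thesis using dim by (simp add: m_part_def)
qed

lemma basis_family_Lambda_space:
  "basis_family (partitions_upto n) (m_part n) (Lambda_space n :: 'k::field_char_0 ncpoly set)"
  unfolding Lambda_space_def
  by (rule triangular_basis_family[of "{}" _ _ "\<lambda>\<mu>. Mon (partition_word \<mu>)"])
    (simp_all add: lookup_m_part)

lemma bij_betw_tail_free_words:
  "bij_betw (\<lambda>(w, \<mu>). concat (bimodal_factors w) @ partition_word \<mu>)
     (tail_free_words n \<times> partitions_upto n) {w. rg_word w \<and> set w \<subseteq> {1..n}}"
proof -
  have convex: "convex_word (partition_word \<mu>)" if "\<mu> \<in> partitions_upto n" for \<mu>
    using that by (auto simp: convex_word_def partitions_upto_def)
  show ?thesis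
    unfolding bij_betw_def
  proof (intro conjI equalityI subsetI)
    show "inj_on (\<lambda>(w, \<mu>). concat (bimodal_factors w) @ partition_word \<mu>)
        (tail_free_words n \<times> partitions_upto n)"
    proof (rule inj_onI, clarify)
      fix w \<mu> w' \<mu>'
      assume w: "w \<in> tail_free_words n" "w' \<in> tail_free_words n"
        and \<mu>: "\<mu> \<in> partitions_upto n" "\<mu>' \<in> partitions_upto n"
        and eq: "concat (bimodal_factors w) @ partition_word \<mu> =
          concat (bimodal_factors w') @ partition_word \<mu>'"
      have "bimodal_factors w = bimodal_factors w'" "partition_word \<mu> = partition_word \<mu>'"
        using bimodal_decomposition_unique[OF tail_free_wordsD(3)[OF w(1)] convex[OF \<mu>(1)]]
          bimodal_decomposition_unique[OF tail_free_wordsD(3)[OF w(2)] convex[OF \<mu>(2)]] eq by auto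
      then show "w = w' \<and> \<mu> = \<mu>'"
        using tail_free_wordsD(4) w \<mu> shape_partition_word unfolding partitions_upto_def
        by (metis (no_types, lifting) mem_Collect_eq)
    qed
  next
    fix u
    assume "u \<in> (\<lambda>(w, \<mu>). concat (bimodal_factors w) @ partition_word \<mu>) `
      (tail_free_words n \<times> partitions_upto n)"
    then obtain w \<mu> where w: "w \<in> tail_free_words n" and \<mu>: "\<mu> \<in> partitions_upto n"
      and u: "u = w @ partition_word \<mu>"
      by (auto simp: tail_free_wordsD(4))
    then show "u \<in> {w. rg_word w \<and> set w \<subseteq> {1..n}}"
      using tail_free_wordsD(1,2)[OF w] rg_word_append set_partition_word[of \<mu>]
        rg_word_convex[OF convex[OF \<mu>]]
      by (auto simp: partitions_upto_def is_partition_def)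
  next
    fix u assume "u \<in> {w. rg_word w \<and> set w \<subseteq> {1..n}}"
    then have u: "rg_word u" "set u \<subseteq> {1..n}" by auto
    note dec = bimodal_decomposition[OF u(1)]
    have sub: "set (concat (bimodal_factors u)) \<subseteq> {1..n}" "set (bimodal_tail u) \<subseteq> {1..n}"
      using u(2) arg_cong[OF dec(3), of set] by auto
    obtain \<mu> where \<mu>: "is_partition \<mu>" "bimodal_tail u = partition_word \<mu>"
      using dec(2) by (auto simp: convex_word_def)
    then have "length \<mu> \<le> n"
      using sub(2) set_partition_word[of \<mu>] by (cases "length \<mu>") (auto simp: is_partition_def)
    then have "\<mu> \<in> partitions_upto n" using \<mu>(1) by (simp add: partitions_upto_def)
    then show "u \<in> (\<lambda>(w, \<mu>). concat (bimodal_factors w) @ partition_word \<mu>) `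
        (tail_free_words n \<times> partitions_upto n)"
      using tail_free_wordsI[OF dec(1) sub(1)] dec(3) \<mu>(2)
      by (intro image_eqI[of _ _ "(concat (bimodal_factors u), \<mu>)"]) auto
  qed
qed

theorem theorem6p1:
  fixes n :: nat
  assumes "1 \<le> n"
  shows "basis_family (tail_free_words n) (bimodal_product n)
           (C_algebra n :: 'k::field_char_0 ncpoly set)
       \<and> (\<exists>!\<phi>. \<phi> \<in> extensional (tensor_space (C_algebra n :: 'k ncpoly set) (Lambda_space n))
             \<and> is_phi n \<phi>)
       \<and> (\<forall>\<phi>. is_phi n \<phi> \<longrightarrow>
             bij_betw \<phi> (tensor_space (C_algebra n :: 'k ncpoly set) (Lambda_space n)) (NCSym n))"
proof -
  let ?T = "tensor_space (C_algebra n :: 'k ncpoly set) (Lambda_space n)"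
  let ?I = "tail_free_words n \<times> partitions_upto n"
  let ?b = "\<lambda>(w, \<mu>). pure_tensor (bimodal_product n w) (m_part n \<mu>) :: _ \<Rightarrow>\<^sub>0 'k"
  let ?b' = "\<lambda>p. m_word n (case p of (w, \<mu>) \<Rightarrow> concat (bimodal_factors w) @ partition_word \<mu>)"
  have source: "basis_family ?I ?b ?T"
    by (rule basis_family_pure_tensor[OF basis_family_C_algebra basis_family_Lambda_space])
  have target: "basis_family ?I ?b' (NCSym n :: 'k ncpoly set)"
    by (rule basis_family_reindex[OF basis_family_NCSym bij_betw_tail_free_words])
  have phi: "is_phi n \<phi> \<longleftrightarrow> linear_map_on pm_scale pm_scale ?T \<phi> \<and> (\<forall>p\<in>?I. \<phi> (?b p) = ?b' p)" for \<phi>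
    by (auto simp: is_phi_def)
  show ?thesis
    unfolding phi
    using basis_family_C_algebra linear_map_on_basis_family[OF source target] by blast
qed

end
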